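(* Let $K$ be a field and $E$ an arbitrary graph for which the Leavitt path algebra $L_K(E)$ is simple. Then the following holds: (1) If $E^0$ is infinite, then $[L_K(E), L_K(E)]$ is a simple Lie $K$-algebra. (2) If $E^0$ is finite and $L_K(E)$ is nontrivial, then $[L_K(E), L_K(E)]$ is a simple Lie $K$-algebra if and only if $1_{L_K(E)}\notin [L_K(E), L_K(E)]$.
   Context: A (directed) graph $E=(E^0,E^1,s,r)$ consists of disjoint sets $E^0$ (vertices) and $E^1$ (edges) and maps $s,r:E^1\to E^0$ (source and range). A vertex $v$ is regular if $0<|r^{-1}(v)|<\infty$. The Leavitt path algebra $L_K(E)$ is the $K$-algebra (not necessarily unital) generated by $E^0$ together with two disjoint copies $E^1$ and $\{e^*\mid e\in E^1\}$ of $E^1$, subject to the following relations for all $v,w\in E^0$, $e,f\in E^1$ ($\delta$ is the Kronecker delta): (1) $vw=\delta_{v,w}w$; (2) $r(e)e=e=e\,s(e)$ and $s(e)e^*=e^*=e^*r(e)$; (3) $e^*f=\delta_{e,f}s(e)$; (4) $v=\sum_{e\in r^{-1}(v)}ee^*$ for every regular vertex $v$. $L_K(E)$ is unital if and only if $E^0$ is finite, and then its identity is $1_{L_K(E)}=\sum_{v\in E^0}v$. A simple Leavitt path algebra $L_K(E)$ is nontrivial if $L_K(E)\not\cong K$. For an associative $K$-algebra $R$ (not necessarily unital), $[R,R]$ is the $K$-span of all commutators $[x,y]=xy-yx$, $x,y\in R$; it is a Lie $K$-algebra under $[x,y]=xy-yx$. A Lie $K$-algebra $L$ is simple if $[L,L]\neq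 0$ and its only Lie ideals ($K$-subspaces $I$ with $[L,I]\subseteq I$) are $0$ and $L$. *)

theory Defs
  imports
    Complex_Main
    "HOL-Library.Poly_Mapping"
    "Graph_Theory.Digraph"
begin

section \<open>Algebras over a field, with explicit carriers\<close>

text \<open>
  The scalars form the type \<open>'k\<close> of class \<^class>\<open>field\<close>. No unit is part of the structure, and the
  multiplication need not be associative: the same record is used for associative algebras and,
  with the bracket as multiplication, for Lie algebras.
\<close>

record ('k, 'a) k_algebra =
  alg_carrier :: "'a set"
  alg_add :: "'a \<Rightarrow> 'a \<Rightarrow> 'a" (infixl \<open>\<boxplus>\<index>\<close> 65)
  alg_zero :: "'a" (\<open>\<zero>\<index>\<close>)
  alg_mult :: "'a \<Rightarrow> 'a \<Rightarrow> 'a" (infixl \<open>\<boxtimes>\<index>\<close> 70)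
  alg_scale :: "'k \<Rightarrow> 'a \<Rightarrow> 'a" (infixr \<open>\<odot>\<index>\<close> 75)

locale nonassoc_algebra =
  fixes A :: "('k::field, 'a) k_algebra" (structure)
  assumes add_closed: "x \<in> alg_carrier A \<Longrightarrow> y \<in> alg_carrier A \<Longrightarrow> x \<boxplus> y \<in> alg_carrier A"
    and zero_closed: "\<zero> \<in> alg_carrier A"
    and mult_closed: "x \<in> alg_carrier A \<Longrightarrow> y \<in> alg_carrier A \<Longrightarrow> x \<boxtimes> y \<in> alg_carrier A"
    and scale_closed: "x \<in> alg_carrier A \<Longrightarrow> c \<odot> x \<in> alg_carrier A"
    and add_assoc: "x \<in> alg_carrier A \<Longrightarrow> y \<in> alg_carrier A \<Longrightarrow> z \<in> alg_carrier A
          \<Longrightarrow> (x \<boxplus> y) \<boxplus> z = x \<boxplus> (y \<boxplus> z)"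
    and add_comm: "x \<in> alg_carrier A \<Longrightarrow> y \<in> alg_carrier A \<Longrightarrow> x \<boxplus> y = y \<boxplus> x"
    and add_zero: "x \<in> alg_carrier A \<Longrightarrow> \<zero> \<boxplus> x = x"
    and add_inverse: "x \<in> alg_carrier A \<Longrightarrow> \<exists>y\<in>alg_carrier A. x \<boxplus> y = \<zero>"
    and scale_add: "x \<in> alg_carrier A \<Longrightarrow> y \<in> alg_carrier A \<Longrightarrow> c \<odot> (x \<boxplus> y) = c \<odot> x \<boxplus> c \<odot> y"
    and add_scale: "x \<in> alg_carrier A \<Longrightarrow> (c + d) \<odot> x = c \<odot> x \<boxplus> d \<odot> x"
    and scale_scale: "x \<in> alg_carrier A \<Longrightarrow> c \<odot> (d \<odot> x) = (c * d) \<odot> x"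
    and one_scale: "x \<in> alg_carrier A \<Longrightarrow> 1 \<odot> x = x"
    and distrib_right: "x \<in> alg_carrier A \<Longrightarrow> y \<in> alg_carrier A \<Longrightarrow> z \<in> alg_carrier A
          \<Longrightarrow> (x \<boxplus> y) \<boxtimes> z = x \<boxtimes> z \<boxplus> y \<boxtimes> z"
    and distrib_left: "x \<in> alg_carrier A \<Longrightarrow> y \<in> alg_carrier A \<Longrightarrow> z \<in> alg_carrier A
          \<Longrightarrow> z \<boxtimes> (x \<boxplus> y) = z \<boxtimes> x \<boxplus> z \<boxtimes> y"
    and scale_mult_left: "x \<in> alg_carrier A \<Longrightarrow> y \<in> alg_carrier A \<Longrightarrow> (c \<odot> x) \<boxtimes> y = c \<odot> (x \<boxtimes> y)"
    and scale_mult_right: "x \<in> alg_carrier A \<Longrightarrow> y \<in> alg_carrier A \<Longrightarrow> x \<boxtimes> (c \<odot> y) = c \<odot> (x \<boxtimes> y)"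

locale assoc_algebra = nonassoc_algebra +
  assumes mult_assoc: "x \<in> alg_carrier A \<Longrightarrow> y \<in> alg_carrier A \<Longrightarrow> z \<in> alg_carrier A
          \<Longrightarrow> (x \<boxtimes> y) \<boxtimes> z = x \<boxtimes> (y \<boxtimes> z)"

locale lie_algebra = nonassoc_algebra +
  assumes alternating: "x \<in> alg_carrier A \<Longrightarrow> x \<boxtimes> x = \<zero>"
    and jacobi: "x \<in> alg_carrier A \<Longrightarrow> y \<in> alg_carrier A \<Longrightarrow> z \<in> alg_carrier A
          \<Longrightarrow> x \<boxtimes> (y \<boxtimes> z) \<boxplus> y \<boxtimes> (z \<boxtimes> x) \<boxplus> z \<boxtimes> (x \<boxtimes> y) = \<zero>"

definition subspace_of :: "('k::field, 'a) k_algebra \<Rightarrow> 'a set \<Rightarrow> bool" where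
  "subspace_of A S \<longleftrightarrow> S \<subseteq> alg_carrier A \<and> \<zero>\<^bsub>A\<^esub> \<in> S \<and>
     (\<forall>x\<in>S. \<forall>y\<in>S. x \<boxplus>\<^bsub>A\<^esub> y \<in> S) \<and> (\<forall>c. \<forall>x\<in>S. c \<odot>\<^bsub>A\<^esub> x \<in> S)"

definition span_of :: "('k::field, 'a) k_algebra \<Rightarrow> 'a set \<Rightarrow> 'a set" where
  "span_of A X = subspace_of A hull X"

definition product_space :: "('k::field, 'a) k_algebra \<Rightarrow> 'a set" where
  "product_space A = span_of A {x \<boxtimes>\<^bsub>A\<^esub> y |x y. x \<in> alg_carrier A \<and> y \<in> alg_carrier A}"

definition two_sided_ideal :: "('k::field, 'a) k_algebra \<Rightarrow> 'a set \<Rightarrow> bool" where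
  "two_sided_ideal A I \<longleftrightarrow> subspace_of A I \<and>
     (\<forall>a\<in>alg_carrier A. \<forall>x\<in>I. a \<boxtimes>\<^bsub>A\<^esub> x \<in> I \<and> x \<boxtimes>\<^bsub>A\<^esub> a \<in> I)"

definition lie_ideal :: "('k::field, 'a) k_algebra \<Rightarrow> 'a set \<Rightarrow> bool" where
  "lie_ideal L I \<longleftrightarrow> subspace_of L I \<and> (\<forall>a\<in>alg_carrier L. \<forall>x\<in>I. a \<boxtimes>\<^bsub>L\<^esub> x \<in> I)"

context nonassoc_algebra
begin

lemma scale_zero_left: "x \<in> alg_carrier A \<Longrightarrow> 0 \<odot> x = \<zero>"
proof -
  assume x: "x \<in> alg_carrier A"
  let ?z = "0 \<odot> x"
  have z: "?z \<in> alg_carrier A" using x by (rule scale_closed)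
  have zz: "?z \<boxplus> ?z = ?z" using add_scale[OF x, of 0 0] by simp
  obtain y where y: "y \<in> alg_carrier A" "?z \<boxplus> y = \<zero>" using add_inverse[OF z] by blast
  have "?z = ?z \<boxplus> (?z \<boxplus> y)" using y z add_comm add_zero zero_closed by metis
  also have "\<dots> = \<zero>" using add_assoc[OF z z y(1)] zz y(2) by simp
  finally show ?thesis .
qed

lemma scale_zero_right: "c \<odot> \<zero> = \<zero>"
  using scale_scale[OF zero_closed, of c 0] scale_zero_left[OF zero_closed] by simp

lemma add_zero_right: "x \<in> alg_carrier A \<Longrightarrow> x \<boxplus> \<zero> = x"
  using add_comm[OF zero_closed] add_zero by metis

lemma add_neg: "x \<in> alg_carrier A \<Longrightarrow> x \<boxplus> (- 1) \<odot> x = \<zero>"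
  using add_scale[of x 1 "- 1"] one_scale scale_zero_left by simp

lemma add_left_commute:
  "x \<in> alg_carrier A \<Longrightarrow> y \<in> alg_carrier A \<Longrightarrow> z \<in> alg_carrier A \<Longrightarrow> x \<boxplus> (y \<boxplus> z) = y \<boxplus> (x \<boxplus> z)"
  by (metis add_assoc add_comm)

lemma mult_zero_right: "x \<in> alg_carrier A \<Longrightarrow> x \<boxtimes> \<zero> = \<zero>"
  using scale_mult_right[OF _ zero_closed, of x 0] scale_zero_left mult_closed zero_closed by metis

lemma mult_zero_left: "x \<in> alg_carrier A \<Longrightarrow> \<zero> \<boxtimes> x = \<zero>"
  using scale_mult_left[OF zero_closed, of x 0] scale_zero_left mult_closed zero_closed by metis

lemma subspace_carrier: "subspace_of A (alg_carrier A)"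
  by (simp add: subspace_of_def add_closed zero_closed scale_closed)

lemma subspace_span: "X \<subseteq> alg_carrier A \<Longrightarrow> subspace_of A (span_of A X)"
  using subspace_carrier unfolding span_of_def hull_def subspace_of_def by blast

lemma ideal_carrier: "two_sided_ideal A (alg_carrier A)"
  by (simp add: two_sided_ideal_def subspace_carrier mult_closed)

lemma ideal_hull:
  assumes "X \<subseteq> alg_carrier A"
  shows "two_sided_ideal A (two_sided_ideal A hull X)"
proof -
  have inter: "two_sided_ideal A (\<Inter>T)" if T: "T \<noteq> {}" "\<And>t. t \<in> T \<Longrightarrow> two_sided_ideal A t" for T
  proof -
    obtain t where t: "t \<in> T" using T(1) by blast
    with T(2) have "t \<subseteq> alg_carrier A" by (simp add: two_sided_ideal_def subspace_of_def)
    with t have "\<Inter>T \<subseteq> alg_carrier A" by blast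
    then show ?thesis
      using T(2) unfolding two_sided_ideal_def subspace_of_def by (simp add: Inter_iff)
  qed
  have "{t. two_sided_ideal A t \<and> X \<subseteq> t} \<noteq> {}" using ideal_carrier assms by blast
  then show ?thesis unfolding hull_def by (rule inter) simp
qed

end

locale simple_assoc_algebra = assoc_algebra +
  assumes product_nonzero: "product_space A \<noteq> {\<zero>}"
    and trivial_ideals: "two_sided_ideal A I \<Longrightarrow> I = {\<zero>} \<or> I = alg_carrier A"

locale simple_lie_algebra = lie_algebra +
  assumes derived_nonzero: "product_space A \<noteq> {\<zero>}"
    and trivial_lie_ideals: "lie_ideal A I \<Longrightarrow> I = {\<zero>} \<or> I = alg_carrier A"

definition alg_one :: "('k::field, 'a) k_algebra \<Rightarrow> 'a" where
  "alg_one A = (THE u. u \<in> alg_carrier A \<and>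
     (\<forall>x\<in>alg_carrier A. u \<boxtimes>\<^bsub>A\<^esub> x = x \<and> x \<boxtimes>\<^bsub>A\<^esub> u = x))"

definition alg_isomorphic :: "('k::field, 'a) k_algebra \<Rightarrow> ('k, 'b) k_algebra \<Rightarrow> bool" where
  "alg_isomorphic A B \<longleftrightarrow> (\<exists>f. bij_betw f (alg_carrier A) (alg_carrier B) \<and>
     (\<forall>x\<in>alg_carrier A. \<forall>y\<in>alg_carrier A. f (x \<boxplus>\<^bsub>A\<^esub> y) = f x \<boxplus>\<^bsub>B\<^esub> f y) \<and>
     (\<forall>x\<in>alg_carrier A. \<forall>y\<in>alg_carrier A. f (x \<boxtimes>\<^bsub>A\<^esub> y) = f x \<boxtimes>\<^bsub>B\<^esub> f y) \<and>
     (\<forall>c. \<forall>x\<in>alg_carrier A. f (c \<odot>\<^bsub>A\<^esub> x) = c \<odot>\<^bsub>B\<^esub> f x))"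

definition base_field_algebra :: "('k::field, 'k) k_algebra" where
  "base_field_algebra =
     \<lparr>alg_carrier = UNIV, alg_add = (+), alg_zero = 0, alg_mult = (*), alg_scale = (*)\<rparr>"


section \<open>The Lie algebra of commutators\<close>

definition commutator :: "('k::field, 'a) k_algebra \<Rightarrow> 'a \<Rightarrow> 'a \<Rightarrow> 'a" where
  "commutator A x y = x \<boxtimes>\<^bsub>A\<^esub> y \<boxplus>\<^bsub>A\<^esub> (- 1) \<odot>\<^bsub>A\<^esub> (y \<boxtimes>\<^bsub>A\<^esub> x)"

definition commutator_space :: "('k::field, 'a) k_algebra \<Rightarrow> 'a set" where
  "commutator_space A = span_of A {commutator A x y |x y. x \<in> alg_carrier A \<and> y \<in> alg_carrier A}"

definition commutator_lie_algebra :: "('k::field, 'a) k_algebra \<Rightarrow> ('k, 'a) k_algebra" where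
  "commutator_lie_algebra A = A\<lparr>alg_carrier := commutator_space A, alg_mult := commutator A\<rparr>"


lemma (in assoc_algebra) commutator_closed:
  "x \<in> alg_carrier A \<Longrightarrow> y \<in> alg_carrier A \<Longrightarrow> commutator A x y \<in> commutator_space A"
  unfolding commutator_space_def span_of_def by (rule hull_inc) blast

lemma (in assoc_algebra) commutator_subspace: "subspace_of A (commutator_space A)"
  unfolding commutator_space_def
  by (rule subspace_span) (auto simp: commutator_def add_closed mult_closed scale_closed)

lemma (in assoc_algebra) lie_algebra_commutator_lie_algebra:
  "lie_algebra (commutator_lie_algebra A)"
proof -
  let ?C = "commutator_space A"
  have sub: "x \<in> alg_carrier A" if "x \<in> ?C" for x
    using commutator_subspace that by (auto simp: subspace_of_def)
  have cl: "\<zero> \<in> ?C" "\<And>x y. x \<in> ?C \<Longrightarrow> y \<in> ?C \<Longrightarrow> x \<boxplus> y \<in> ?C" "\<And>c x. x \<in> ?C \<Longrightarrow> c \<odot> x \<in> ?C"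
    using commutator_subspace by (auto simp: subspace_of_def)
  note closed = add_closed mult_closed scale_closed
  note expand = distrib_left distrib_right scale_add scale_mult_left scale_mult_right scale_scale
    one_scale mult_assoc
  note ac = add_assoc add_comm add_left_commute
  have six: "a \<boxplus> (b \<boxplus> (c \<boxplus> (d \<boxplus> (e \<boxplus> (f \<boxplus> ((- 1) \<odot> a \<boxplus> ((- 1) \<odot> b \<boxplus>
      ((- 1) \<odot> c \<boxplus> ((- 1) \<odot> d \<boxplus> ((- 1) \<odot> e \<boxplus> (- 1) \<odot> f)))))))))) = \<zero>"
    if "a \<in> alg_carrier A" "b \<in> alg_carrier A" "c \<in> alg_carrier A"
      "d \<in> alg_carrier A" "e \<in> alg_carrier A" "f \<in> alg_carrier A" for a b c d e f
    using add_neg[of "a \<boxplus> (b \<boxplus> (c \<boxplus> (d \<boxplus> (e \<boxplus> f))))"] that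
    by (simp add: scale_add closed add_assoc)
  have jac: "commutator A x (commutator A y z) \<boxplus> commutator A y (commutator A z x)
      \<boxplus> commutator A z (commutator A x y) = \<zero>"
    if "x \<in> alg_carrier A" "y \<in> alg_carrier A" "z \<in> alg_carrier A" for x y z
    using that by (simp add: commutator_def expand closed ac six)
  have left: "commutator A (x \<boxplus> y) z = commutator A x z \<boxplus> commutator A y z"
    and right: "commutator A z (x \<boxplus> y) = commutator A z x \<boxplus> commutator A z y"
    if "x \<in> alg_carrier A" "y \<in> alg_carrier A" "z \<in> alg_carrier A" for x y z
    using that by (simp_all add: commutator_def expand closed ac)
  have scale: "commutator A (c \<odot> x) y = c \<odot> commutator A x y"
      "commutator A x (c \<odot> y) = c \<odot> commutator A x y"
    if "x \<in> alg_carrier A" "y \<in> alg_carrier A" for c x y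
    using that by (simp_all add: commutator_def expand closed)
  have self: "commutator A x x = \<zero>" if "x \<in> alg_carrier A" for x
    using that by (simp add: commutator_def add_neg closed)
  have inverse: "\<exists>y\<in>?C. x \<boxplus> y = \<zero>" if "x \<in> ?C" for x
    using cl(3)[OF that, of "- 1"] add_neg[OF sub[OF that]] by blast
  note rules = cl inverse add_assoc[OF sub sub sub] add_comm[OF sub sub] add_zero[OF sub]
    commutator_closed[OF sub sub] scale_add[OF sub sub] add_scale[OF sub] scale_scale[OF sub]
    one_scale[OF sub] left[OF sub sub sub] right[OF sub sub sub] scale[OF sub sub]
    self[OF sub] jac[OF sub sub sub]
  have L: "alg_carrier (commutator_lie_algebra A) = ?C"
      "alg_add (commutator_lie_algebra A) = alg_add A"
      "alg_zero (commutator_lie_algebra A) = alg_zero A"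
      "alg_mult (commutator_lie_algebra A) = commutator A"
      "alg_scale (commutator_lie_algebra A) = alg_scale A"
    by (simp_all add: commutator_lie_algebra_def)
  show ?thesis
    by (unfold_locales; unfold L; rule rules; assumption)
qed

section \<open>Quotient algebras\<close>

definition alg_coset :: "('k::field, 'a) k_algebra \<Rightarrow> 'a set \<Rightarrow> 'a \<Rightarrow> 'a set" where
  "alg_coset A I x = {x \<boxplus>\<^bsub>A\<^esub> i |i. i \<in> I}"

text \<open>
  The operations on cosets are unions over all choices of representatives; for an ideal \<open>I\<close> all
  choices give the same coset, see \<open>quotient_add\<close>, \<open>quotient_mult\<close> and \<open>quotient_scale\<close> below.
\<close>

definition quotient_algebra :: "('k::field, 'a) k_algebra \<Rightarrow> 'a set \<Rightarrow> ('k, 'a set) k_algebra" where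
  "quotient_algebra A I =
     \<lparr>alg_carrier = alg_coset A I ` alg_carrier A,
      alg_add = (\<lambda>X Y. \<Union>x\<in>X. \<Union>y\<in>Y. alg_coset A I (x \<boxplus>\<^bsub>A\<^esub> y)),
      alg_zero = alg_coset A I \<zero>\<^bsub>A\<^esub>,
      alg_mult = (\<lambda>X Y. \<Union>x\<in>X. \<Union>y\<in>Y. alg_coset A I (x \<boxtimes>\<^bsub>A\<^esub> y)),
      alg_scale = (\<lambda>c X. \<Union>x\<in>X. alg_coset A I (c \<odot>\<^bsub>A\<^esub> x))\<rparr>"


context assoc_algebra
begin

context
  fixes I
  assumes I: "two_sided_ideal A I"
begin

lemma ideal_sub: "i \<in> I \<Longrightarrow> i \<in> alg_carrier A"
  and ideal_zero: "\<zero> \<in> I"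
  and ideal_add: "i \<in> I \<Longrightarrow> j \<in> I \<Longrightarrow> i \<boxplus> j \<in> I"
  and ideal_scale: "i \<in> I \<Longrightarrow> c \<odot> i \<in> I"
  and ideal_mult_left: "x \<in> alg_carrier A \<Longrightarrow> i \<in> I \<Longrightarrow> x \<boxtimes> i \<in> I"
  and ideal_mult_right: "x \<in> alg_carrier A \<Longrightarrow> i \<in> I \<Longrightarrow> i \<boxtimes> x \<in> I"
  using I by (auto simp: two_sided_ideal_def subspace_of_def)

lemma coset_self: "x \<in> alg_carrier A \<Longrightarrow> x \<in> alg_coset A I x"
  using ideal_zero add_zero_right[of x] by (force simp: alg_coset_def)

lemma coset_add_ideal:
  assumes x: "x \<in> alg_carrier A" and i: "i \<in> I"
  shows "alg_coset A I (x \<boxplus> i) = alg_coset A I x"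
proof
  note i' = ideal_sub[OF i]
  show "alg_coset A I (x \<boxplus> i) \<subseteq> alg_coset A I x"
    using x i i' ideal_add[OF i] by (auto simp: alg_coset_def add_assoc ideal_sub)
  show "alg_coset A I x \<subseteq> alg_coset A I (x \<boxplus> i)"
  proof
    fix y assume "y \<in> alg_coset A I x"
    then obtain j where j: "j \<in> I" "y = x \<boxplus> j" by (auto simp: alg_coset_def)
    have ni: "(- 1) \<odot> i \<in> I" using i by (rule ideal_scale)
    have "i \<boxplus> ((- 1) \<odot> i \<boxplus> j) = j"
      using add_assoc[OF i' ideal_sub[OF ni] ideal_sub[OF j(1)]] add_neg[OF i']
        add_zero[OF ideal_sub[OF j(1)]] by simp
    then have "y = (x \<boxplus> i) \<boxplus> ((- 1) \<odot> i \<boxplus> j)"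
      using j x i' ni by (simp add: add_assoc ideal_sub add_closed)
    then show "y \<in> alg_coset A I (x \<boxplus> i)"
      using ideal_add[OF ni j(1)] by (auto simp: alg_coset_def)
  qed
qed

lemma quotient_add:
  assumes x: "x \<in> alg_carrier A" and y: "y \<in> alg_carrier A"
  shows "alg_coset A I x \<boxplus>\<^bsub>quotient_algebra A I\<^esub> alg_coset A I y = alg_coset A I (x \<boxplus> y)"
proof -
  have "alg_coset A I (x' \<boxplus> y') = alg_coset A I (x \<boxplus> y)"
    if xy: "x' \<in> alg_coset A I x" "y' \<in> alg_coset A I y" for x' y'
  proof -
    obtain i j where ij: "i \<in> I" "x' = x \<boxplus> i" "j \<in> I" "y' = y \<boxplus> j"
      using xy by (auto simp: alg_coset_def)
    have "x' \<boxplus> y' = (x \<boxplus> y) \<boxplus> (i \<boxplus> j)"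
      using x y ij by (simp add: ideal_sub add_assoc add_closed add_left_commute)
    then show ?thesis using x y ij by (simp add: coset_add_ideal ideal_add add_closed)
  qed
  moreover have "alg_coset A I x \<noteq> {}" "alg_coset A I y \<noteq> {}"
    using coset_self[OF x] coset_self[OF y] by blast+
  ultimately show ?thesis by (simp add: quotient_algebra_def SUP_eq_const)
qed

lemma quotient_mult:
  assumes x: "x \<in> alg_carrier A" and y: "y \<in> alg_carrier A"
  shows "alg_coset A I x \<boxtimes>\<^bsub>quotient_algebra A I\<^esub> alg_coset A I y = alg_coset A I (x \<boxtimes> y)"
proof -
  have "alg_coset A I (x' \<boxtimes> y') = alg_coset A I (x \<boxtimes> y)"
    if xy: "x' \<in> alg_coset A I x" "y' \<in> alg_coset A I y" for x' y'
  proof -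
    obtain i j where ij: "i \<in> I" "x' = x \<boxplus> i" "j \<in> I" "y' = y \<boxplus> j"
      using xy by (auto simp: alg_coset_def)
    have "x' \<boxtimes> y' = (x \<boxtimes> y) \<boxplus> (x \<boxtimes> j \<boxplus> (i \<boxtimes> y \<boxplus> i \<boxtimes> j))"
      using x y ij
      by (simp add: ideal_sub add_assoc add_closed add_left_commute mult_closed
          distrib_left distrib_right)
    then show ?thesis using x y ij
      by (simp add: coset_add_ideal ideal_add mult_closed ideal_mult_left ideal_mult_right ideal_sub)
  qed
  moreover have "alg_coset A I x \<noteq> {}" "alg_coset A I y \<noteq> {}"
    using coset_self[OF x] coset_self[OF y] by blast+
  ultimately show ?thesis by (simp add: quotient_algebra_def SUP_eq_const)
qed

lemma quotient_scale:
  assumes x: "x \<in> alg_carrier A"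
  shows "c \<odot>\<^bsub>quotient_algebra A I\<^esub> alg_coset A I x = alg_coset A I (c \<odot> x)"
proof -
  have "alg_coset A I (c \<odot> x') = alg_coset A I (c \<odot> x)" if "x' \<in> alg_coset A I x" for x'
    using that x
    by (auto simp: alg_coset_def[of A I x] scale_add ideal_sub coset_add_ideal ideal_scale scale_closed)
  moreover have "alg_coset A I x \<noteq> {}" using coset_self[OF x] by blast
  ultimately show ?thesis by (simp add: quotient_algebra_def SUP_eq_const)
qed

lemma quotient_zero: "\<zero>\<^bsub>quotient_algebra A I\<^esub> = alg_coset A I \<zero>"
  by (simp add: quotient_algebra_def)

lemma quotient_carrier: "alg_carrier (quotient_algebra A I) = alg_coset A I ` alg_carrier A"
  by (simp add: quotient_algebra_def)

lemma coset_eq_iff: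
  assumes x: "x \<in> alg_carrier A" and y: "y \<in> alg_carrier A"
  shows "alg_coset A I x = alg_coset A I y \<longleftrightarrow> x \<boxplus> (- 1) \<odot> y \<in> I"
proof
  assume "alg_coset A I x = alg_coset A I y"
  then obtain i where i: "i \<in> I" "x = y \<boxplus> i" using coset_self[OF x] by (auto simp: alg_coset_def)
  then have "x \<boxplus> (- 1) \<odot> y = i \<boxplus> (y \<boxplus> (- 1) \<odot> y)"
    using y by (metis add_comm add_assoc ideal_sub scale_closed)
  also have "\<dots> = i" using add_neg[OF y] add_zero add_comm zero_closed i ideal_sub by metis
  finally show "x \<boxplus> (- 1) \<odot> y \<in> I" using i by simp
next
  assume d: "x \<boxplus> (- 1) \<odot> y \<in> I"
  have "y \<boxplus> (x \<boxplus> (- 1) \<odot> y) = x"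
    using add_left_commute[OF y x scale_closed[OF y]] add_neg[OF y] add_zero[OF x]
      add_comm[OF x zero_closed] by simp
  then show "alg_coset A I x = alg_coset A I y" using coset_add_ideal[OF y d] by simp
qed

lemma assoc_algebra_quotient: "assoc_algebra (quotient_algebra A I)"
proof -
  note Q = quotient_add quotient_mult quotient_scale quotient_zero
  note closed = add_closed mult_closed scale_closed zero_closed
  show ?thesis
  proof
    fix X assume "X \<in> alg_carrier (quotient_algebra A I)"
    then obtain x where x: "x \<in> alg_carrier A" "X = alg_coset A I x"
      by (auto simp: quotient_carrier)
    then show "\<exists>Y\<in>alg_carrier (quotient_algebra A I).
        X \<boxplus>\<^bsub>quotient_algebra A I\<^esub> Y = \<zero>\<^bsub>quotient_algebra A I\<^esub>"
      by (intro bexI[of _ "alg_coset A I ((- 1) \<odot> x)"])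
        (simp_all add: quotient_carrier Q closed add_neg)
  qed (auto simp: quotient_carrier Q closed add_assoc add_zero scale_add add_scale scale_scale
      one_scale distrib_left distrib_right scale_mult_left scale_mult_right mult_assoc
      add_zero_right add_comm add_left_commute)
qed

end

end


section \<open>Free associative algebras\<close>

text \<open>
  Words are wrapped lists under concatenation, written additively so that the convolution product
  of \<^theory>\<open>HOL-Library.Poly_Mapping\<close> on finitely supported functions is the product of
  noncommutative polynomials.
\<close>

datatype 'g fword = FWord (letters: "'g list")

instantiation fword :: (type) monoid_add
begin
definition zero_fword :: "'a fword" where "zero_fword = FWord []"
definition plus_fword :: "'a fword \<Rightarrow> 'a fword \<Rightarrow> 'a fword" where
  "plus_fword u w = FWord (letters u @ letters w)"
instance by standard (simp_all add: zero_fword_def plus_fword_def)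
end

type_synonym ('g, 'k) ncpoly = "'g fword \<Rightarrow>\<^sub>0 'k"

definition generator :: "'g \<Rightarrow> ('g, 'k::field) ncpoly" where
  "generator g = Poly_Mapping.single (FWord [g]) 1"

text \<open>The non-unital free algebra on the set \<open>G\<close>: combinations of nonempty words in \<open>G\<close>.\<close>

definition free_algebra :: "'g set \<Rightarrow> ('k::field, ('g, 'k) ncpoly) k_algebra" where
  "free_algebra G =
     \<lparr>alg_carrier = {p. \<forall>w\<in>Poly_Mapping.keys p. letters w \<noteq> [] \<and> set (letters w) \<subseteq> G},
      alg_add = (+), alg_zero = 0, alg_mult = (*),
      alg_scale = (\<lambda>c. Poly_Mapping.map ((*) c))\<rparr>"

lemma ncpoly_sum_monomials:
  "p = (\<Sum>w\<in>Poly_Mapping.keys p. Poly_Mapping.single w (Poly_Mapping.lookup p w))"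
  by (rule poly_mapping_eqI) (simp add: lookup_sum lookup_single when_def in_keys_iff)

lemma assoc_algebra_free:
  fixes G :: "'g set"
  shows "assoc_algebra (free_algebra G :: ('k::field, ('g, 'k) ncpoly) k_algebra)"
proof -
  have scale: "Poly_Mapping.map ((*) c) p = Poly_Mapping.single 0 c * p"
    for c :: 'k and p :: "('g, 'k) ncpoly"
    by (rule mult_map_scale_conv_mult)
  have comm: "p * Poly_Mapping.single 0 c = Poly_Mapping.single 0 c * p"
    for c :: 'k and p :: "('g, 'k) ncpoly"
    by (subst (1 2) ncpoly_sum_monomials)
      (simp add: sum_distrib_left sum_distrib_right mult_single mult.commute)
  have ss: "Poly_Mapping.single 0 c * (Poly_Mapping.single 0 d * p) = Poly_Mapping.single 0 (c * d) * p"
    for c d :: 'k and p :: "('g, 'k) ncpoly"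
    by (simp add: mult.assoc[symmetric] mult_single)
  have pull: "p * (Poly_Mapping.single 0 c * q) = Poly_Mapping.single 0 c * (p * q)"
    for c :: 'k and p q :: "('g, 'k) ncpoly"
    by (simp add: mult.assoc[symmetric] comm)
  let ?C = "{p :: ('g, 'k) ncpoly.
    \<forall>w\<in>Poly_Mapping.keys p. letters w \<noteq> [] \<and> set (letters w) \<subseteq> G}"
  have cl: "0 \<in> ?C" "\<And>p q. p \<in> ?C \<Longrightarrow> q \<in> ?C \<Longrightarrow> p + q \<in> ?C"
    by (simp, use keys_add in fast)
  have mult: "p * q \<in> ?C" if "p \<in> ?C" "q \<in> ?C" for p q
    using that keys_mult[of p q] by (fastforce simp: plus_fword_def)
  have sc: "Poly_Mapping.single 0 c * p \<in> ?C" if "p \<in> ?C" for c p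
    using that unfolding scale[symmetric] by (auto simp: in_keys_iff map.rep_eq when_def)
  have inv: "\<exists>q\<in>?C. p + q = 0" if "p \<in> ?C" for p
    using that by (intro bexI[of _ "- p"]) (auto simp: in_keys_iff)
  have F: "alg_carrier (free_algebra G :: ('k, _) k_algebra) = ?C"
      "alg_add (free_algebra G :: ('k, _) k_algebra) = (+)"
      "alg_zero (free_algebra G :: ('k, _) k_algebra) = 0"
      "alg_mult (free_algebra G :: ('k, _) k_algebra) = (*)"
      "alg_scale (free_algebra G :: ('k, _) k_algebra) = (\<lambda>c p. Poly_Mapping.single 0 c * p)"
    by (simp_all add: free_algebra_def scale fun_eq_iff)
  have one: "Poly_Mapping.single 0 1 * p = p" for p :: "('g, 'k) ncpoly" by simp
  have add_scale: "Poly_Mapping.single 0 (c + d) * p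
      = Poly_Mapping.single 0 c * p + Poly_Mapping.single 0 d * p" for c d and p :: "('g, 'k) ncpoly"
    by (simp add: single_add distrib_right)
  note rules = cl mult sc inv add.assoc add.commute add_0_left distrib_left distrib_right
    add_scale ss one mult.assoc pull
  show ?thesis
    by (unfold_locales; unfold F; rule rules; assumption)
qed

definition presented_algebra ::
    "'g set \<Rightarrow> ('g, 'k::field) ncpoly set \<Rightarrow> ('k, ('g, 'k) ncpoly set) k_algebra" where
  "presented_algebra G R =
     quotient_algebra (free_algebra G) (two_sided_ideal (free_algebra G) hull R)"


section \<open>Leavitt path algebras\<close>

text \<open>
  The source map is \<^const>\<open>tail\<close> and the range map is \<^const>\<open>head\<close>; the relations below follow the
  convention in which the range is the left unit of an edge.
\<close>

datatype ('v, 'e) lpa_gen = Vertex 'v | Edge 'e | Ghost 'e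

definition lpa_gens :: "('v, 'e) pre_digraph \<Rightarrow> ('v, 'e) lpa_gen set" where
  "lpa_gens E = Vertex ` verts E \<union> Edge ` arcs E \<union> Ghost ` arcs E"

abbreviation gvert :: "'v \<Rightarrow> (('v, 'e) lpa_gen, 'k::field) ncpoly" where
  "gvert v \<equiv> generator (Vertex v)"

abbreviation gedge :: "'e \<Rightarrow> (('v, 'e) lpa_gen, 'k::field) ncpoly" where
  "gedge e \<equiv> generator (Edge e)"

abbreviation gghost :: "'e \<Rightarrow> (('v, 'e) lpa_gen, 'k::field) ncpoly" where
  "gghost e \<equiv> generator (Ghost e)"

definition edges_into :: "('v, 'e) pre_digraph \<Rightarrow> 'v \<Rightarrow> 'e set" where
  "edges_into E v = {e \<in> arcs E. head E e = v}"

definition regular_vertex :: "('v, 'e) pre_digraph \<Rightarrow> 'v \<Rightarrow> bool" where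
  "regular_vertex E v \<longleftrightarrow> v \<in> verts E \<and> finite (edges_into E v) \<and> edges_into E v \<noteq> {}"

definition lpa_relations :: "('v, 'e) pre_digraph \<Rightarrow> (('v, 'e) lpa_gen, 'k::field) ncpoly set" where
  "lpa_relations E =
     {gvert v * gvert w - (if v = w then gvert w else 0) |v w. v \<in> verts E \<and> w \<in> verts E} \<union>
     {gvert (head E e) * gedge e - gedge e |e. e \<in> arcs E} \<union>
     {gedge e * gvert (tail E e) - gedge e |e. e \<in> arcs E} \<union>
     {gvert (tail E e) * gghost e - gghost e |e. e \<in> arcs E} \<union>
     {gghost e * gvert (head E e) - gghost e |e. e \<in> arcs E} \<union>
     {gghost e * gedge f - (if e = f then gvert (tail E e) else 0) |e f.
        e \<in> arcs E \<and> f \<in> arcs E} \<union>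
     {gvert v - (\<Sum>e\<in>edges_into E v. gedge e * gghost e) |v. regular_vertex E v}"

text \<open>The first argument only fixes the field of scalars.\<close>

definition leavitt_path_algebra ::
    "'k::field itself \<Rightarrow> ('v, 'e) pre_digraph
      \<Rightarrow> ('k, (('v, 'e) lpa_gen, 'k) ncpoly set) k_algebra" where
  "leavitt_path_algebra _ E = presented_algebra (lpa_gens E) (lpa_relations E)"

lemma free_generator: "g \<in> X \<Longrightarrow> generator g \<in> alg_carrier (free_algebra X)"
  by (simp add: free_algebra_def generator_def)

lemma free_scale_minus: "(- 1) \<odot>\<^bsub>free_algebra X\<^esub> p = - p"
  by (simp add: free_algebra_def mult_map_scale_conv_mult single_uminus)

lemma free_simps:
  "alg_add (free_algebra X) = (+)" "alg_zero (free_algebra X) = 0" "alg_mult (free_algebra X) = (*)"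
  by (simp_all add: free_algebra_def)

lemma free_zero: "0 \<in> alg_carrier (free_algebra X)"
  and free_add: "p \<in> alg_carrier (free_algebra X) \<Longrightarrow> q \<in> alg_carrier (free_algebra X)
    \<Longrightarrow> p + q \<in> alg_carrier (free_algebra X)"
  and free_mult: "p \<in> alg_carrier (free_algebra X) \<Longrightarrow> q \<in> alg_carrier (free_algebra X)
    \<Longrightarrow> p * q \<in> alg_carrier (free_algebra X)"
  and free_diff: "p \<in> alg_carrier (free_algebra X) \<Longrightarrow> q \<in> alg_carrier (free_algebra X)
    \<Longrightarrow> p - q \<in> alg_carrier (free_algebra X)"
proof -
  interpret F: assoc_algebra "free_algebra X" by (rule assoc_algebra_free)
  show "0 \<in> alg_carrier (free_algebra X)" using F.zero_closed by (simp add: free_simps)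
  show "p + q \<in> alg_carrier (free_algebra X)" "p * q \<in> alg_carrier (free_algebra X)"
      "p - q \<in> alg_carrier (free_algebra X)"
    if "p \<in> alg_carrier (free_algebra X)" "q \<in> alg_carrier (free_algebra X)"
    using F.add_closed[OF that] F.mult_closed[OF that]
      F.add_closed[OF that(1) F.scale_closed[OF that(2), of "- 1"]]
    by (simp_all add: free_simps free_scale_minus)
qed

lemma free_sum:
  "(\<And>i. i \<in> J \<Longrightarrow> f i \<in> alg_carrier (free_algebra X)) \<Longrightarrow> sum f J \<in> alg_carrier (free_algebra X)"
  by (induction J rule: infinite_finite_induct) (auto simp: free_zero free_add)

context wf_digraph
begin

abbreviation lpa_free :: "('k::field, (('a, 'b) lpa_gen, 'k) ncpoly) k_algebra" where
  "lpa_free \<equiv> free_algebra (lpa_gens G)"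

abbreviation lpa_ideal :: "(('a, 'b) lpa_gen, 'k::field) ncpoly set" where
  "lpa_ideal \<equiv> two_sided_ideal lpa_free hull lpa_relations G"

lemma lpa_generators:
  "v \<in> verts G \<Longrightarrow> gvert v \<in> alg_carrier lpa_free"
  "e \<in> arcs G \<Longrightarrow> gedge e \<in> alg_carrier lpa_free"
  "e \<in> arcs G \<Longrightarrow> gghost e \<in> alg_carrier lpa_free"
  by (auto intro!: free_generator simp: lpa_gens_def)

lemma lpa_relations_carrier:
  "lpa_relations G \<subseteq> alg_carrier lpa_free"
  unfolding lpa_relations_def
  by (auto intro!: free_diff free_mult free_sum free_zero lpa_generators
      simp: edges_into_def regular_vertex_def)

lemma lpa_ideal: "two_sided_ideal lpa_free lpa_ideal"
  by (rule nonassoc_algebra.ideal_hull)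
    (use assoc_algebra_free lpa_relations_carrier in \<open>auto simp: assoc_algebra_def\<close>)

lemma leavitt_path_algebra_eq:
  "leavitt_path_algebra TYPE('k::field) G = quotient_algebra lpa_free lpa_ideal"
  by (simp add: leavitt_path_algebra_def presented_algebra_def)

lemma assoc_algebra_leavitt_path_algebra:
  "assoc_algebra (leavitt_path_algebra TYPE('k::field) G)"
  unfolding leavitt_path_algebra_eq
  by (rule assoc_algebra.assoc_algebra_quotient[OF assoc_algebra_free lpa_ideal])

lemma alg_one_leavitt_path_algebra:
  assumes fin: "finite (verts G)"
  shows "alg_one (leavitt_path_algebra TYPE('k::field) G)
    = alg_coset lpa_free lpa_ideal (\<Sum>v\<in>verts G. gvert v)"
proof -
  let ?F = "lpa_free :: ('k, _) k_algebra" and ?I = "lpa_ideal :: (_, 'k) ncpoly set"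
  let ?L = "leavitt_path_algebra TYPE('k::field) G"
  define u :: "(('a, 'b) lpa_gen, 'k) ncpoly" where "u = (\<Sum>v\<in>verts G. gvert v)"
  interpret F: assoc_algebra ?F by (rule assoc_algebra_free)
  have u: "u \<in> alg_carrier ?F" unfolding u_def by (intro free_sum lpa_generators)
  have I_zero: "0 \<in> ?I" using F.ideal_zero[OF lpa_ideal] by (simp add: free_simps)
  have I_add: "x + y \<in> ?I" if "x \<in> ?I" "y \<in> ?I" for x y
    using F.ideal_add[OF lpa_ideal that] by (simp add: free_simps)
  have I_diff: "x - y \<in> ?I" if "x \<in> ?I" "y \<in> ?I" for x y
    using F.ideal_add[OF lpa_ideal that(1) F.ideal_scale[OF lpa_ideal that(2), of "- 1"]]
    by (simp add: free_simps free_scale_minus)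
  have I_left: "x * y \<in> ?I" if "x \<in> alg_carrier ?F" "y \<in> ?I" for x y
    using F.ideal_mult_left[OF lpa_ideal that] by (simp add: free_simps)
  have I_right: "y * x \<in> ?I" if "x \<in> alg_carrier ?F" "y \<in> ?I" for x y
    using F.ideal_mult_right[OF lpa_ideal that] by (simp add: free_simps)
  have I_sum: "sum f J \<in> ?I" if "\<And>j. j \<in> J \<Longrightarrow> f j \<in> ?I" for f :: "'z \<Rightarrow> _" and J
    using that by (induction J rule: infinite_finite_induct) (auto simp: I_zero I_add)
  have rel: "r \<in> ?I" if "r \<in> lpa_relations G" for r by (rule hull_inc[OF that])

  have vert: "u * gvert w - gvert w \<in> ?I" "gvert w * u - gvert w \<in> ?I" if w: "w \<in> verts G" for w
  proof -
    have r: "gvert v * gvert v' - (if v = v' then gvert v' else 0) \<in> ?I"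
      if "v \<in> verts G" "v' \<in> verts G" for v v'
      by (rule rel) (use that in \<open>unfold lpa_relations_def, blast\<close>)
    have "u * gvert w - gvert w = (\<Sum>v\<in>verts G. gvert v * gvert w - (if v = w then gvert w else 0))"
      using fin w by (simp add: u_def sum_distrib_right sum_subtractf)
    also have "\<dots> \<in> ?I" by (intro I_sum r w)
    finally show "u * gvert w - gvert w \<in> ?I" .
    have "gvert w * u - gvert w = (\<Sum>v\<in>verts G. gvert w * gvert v - (if w = v then gvert v else 0))"
      using fin w by (simp add: u_def sum_distrib_left sum_subtractf)
    also have "\<dots> \<in> ?I" by (intro I_sum r w)
    finally show "gvert w * u - gvert w \<in> ?I" .
  qed
  have left: "u * x - x \<in> ?I"
    if "w \<in> verts G" "x \<in> alg_carrier ?F" "gvert w * x - x \<in> ?I" for w x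
  proof -
    have "u * x - x = (u * gvert w - gvert w) * x + (gvert w * x - x) - u * (gvert w * x - x)"
      by (simp add: algebra_simps)
    also have "\<dots> \<in> ?I" using that vert(1) u by (simp add: I_add I_diff I_left I_right)
    finally show ?thesis .
  qed
  have right: "x * u - x \<in> ?I"
    if "w \<in> verts G" "x \<in> alg_carrier ?F" "x * gvert w - x \<in> ?I" for w x
  proof -
    have "x * u - x = x * (gvert w * u - gvert w) + (x * gvert w - x) - (x * gvert w - x) * u"
      by (simp add: algebra_simps)
    also have "\<dots> \<in> ?I" using that vert(2) u by (simp add: I_add I_diff I_left I_right)
    finally show ?thesis .
  qed
  have edge: "gvert (head G e) * gedge e - gedge e \<in> ?I" "gedge e * gvert (tail G e) - gedge e \<in> ?I"
    "gvert (tail G e) * gghost e - gghost e \<in> ?I" "gghost e * gvert (head G e) - gghost e \<in> ?I"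
    if "e \<in> arcs G" for e
  proof -
    show "gvert (head G e) * gedge e - gedge e \<in> ?I"
      by (rule rel, unfold lpa_relations_def, rule UnI1, rule UnI1, rule UnI1, rule UnI1, rule UnI1,
          rule UnI2) (use that in blast)
    show "gedge e * gvert (tail G e) - gedge e \<in> ?I"
      by (rule rel, unfold lpa_relations_def, rule UnI1, rule UnI1, rule UnI1, rule UnI1,
          rule UnI2) (use that in blast)
    show "gvert (tail G e) * gghost e - gghost e \<in> ?I"
      by (rule rel, unfold lpa_relations_def, rule UnI1, rule UnI1, rule UnI1, rule UnI2)
        (use that in blast)
    show "gghost e * gvert (head G e) - gghost e \<in> ?I"
      by (rule rel, unfold lpa_relations_def, rule UnI1, rule UnI1, rule UnI2) (use that in blast)
  qed
  have gens: "u * generator g - generator g \<in> ?I \<and> generator g * u - generator g \<in> ?I"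
    if g: "g \<in> lpa_gens G" for g
  proof -
    consider (v) v where "g = Vertex v" "v \<in> verts G"
      | (e) e where "g = Edge e" "e \<in> arcs G" | (gh) e where "g = Ghost e" "e \<in> arcs G"
      using g by (auto simp: lpa_gens_def)
    then show ?thesis
    proof cases
      case v then show ?thesis using vert by simp
    next
      case e
      then show ?thesis
        by (simp add: left[OF _ _ edge(1)] right[OF _ _ edge(2)] lpa_generators)
    next
      case gh
      then show ?thesis
        by (simp add: left[OF _ _ edge(3)] right[OF _ _ edge(4)] lpa_generators)
    qed
  qed

  have monom: "u * Poly_Mapping.single (FWord xs) c - Poly_Mapping.single (FWord xs) c \<in> ?I \<and>
      Poly_Mapping.single (FWord xs) c * u - Poly_Mapping.single (FWord xs) c \<in> ?I"
    if xs: "xs \<noteq> []" "set xs \<subseteq> lpa_gens G" for xs c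
  proof
    let ?m = "\<lambda>xs. Poly_Mapping.single (FWord xs) c :: (_, 'k) ncpoly"
    have m: "?m ys \<in> alg_carrier ?F" if "ys \<noteq> []" "set ys \<subseteq> lpa_gens G" for ys
      using that by (simp add: free_algebra_def)
    have scale: "Poly_Mapping.single 0 c * x \<in> ?I" if "x \<in> ?I" for x
      using F.ideal_scale[OF lpa_ideal that, of c]
      by (simp add: free_algebra_def mult_map_scale_conv_mult)
    have split: "?m (xs @ ys) = Poly_Mapping.single (FWord xs) a * Poly_Mapping.single (FWord ys) b"
      if "a * b = c" for xs ys a b
      using that by (simp add: mult_single plus_fword_def)
    obtain g ys where g: "xs = g # ys" using xs by (cases xs) auto
    obtain h zs where h: "xs = zs @ [h]" using xs by (cases xs rule: rev_cases) auto
    have gh: "g \<in> lpa_gens G" using xs(2) unfolding g by simp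
    have hh: "h \<in> lpa_gens G" using xs(2) unfolding h by simp
    show "u * ?m xs - ?m xs \<in> ?I"
    proof (cases "ys = []")
      case True
      have "?m xs = generator g * Poly_Mapping.single 0 c"
        using True g by (simp add: generator_def mult_single)
      moreover have "generator g * Poly_Mapping.single 0 c = Poly_Mapping.single 0 c * generator g"
        by (simp add: generator_def mult_single)
      moreover have "u * generator g * Poly_Mapping.single 0 c
          = Poly_Mapping.single 0 c * (u * generator g)"
        unfolding u_def sum_distrib_left sum_distrib_right
        by (simp add: generator_def mult_single)
      ultimately have "u * ?m xs - ?m xs = Poly_Mapping.single 0 c * (u * generator g - generator g)"
        by (simp add: algebra_simps)
      then show ?thesis using scale gens[OF gh] by simp
    next
      case False
      have "?m xs = generator g * ?m ys" using split[of 1 c "[g]" ys] g by (simp add: generator_def)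
      then have "u * ?m xs - ?m xs = (u * generator g - generator g) * ?m ys"
        by (simp add: algebra_simps)
      then show ?thesis using gens[OF gh] m[of ys] False xs(2) unfolding g by (auto intro: I_right)
    qed
    show "?m xs * u - ?m xs \<in> ?I"
    proof (cases "zs = []")
      case True
      have "?m xs = Poly_Mapping.single 0 c * generator h"
        using True h by (simp add: generator_def mult_single)
      then have "?m xs * u - ?m xs = Poly_Mapping.single 0 c * (generator h * u - generator h)"
        by (simp add: algebra_simps)
      then show ?thesis using scale gens[OF hh] by simp
    next
      case False
      have "?m xs = ?m zs * generator h" using split[of c 1 zs "[h]"] h by (simp add: generator_def)
      then have "?m xs * u - ?m xs = ?m zs * (generator h * u - generator h)"
        by (simp add: algebra_simps)
      then show ?thesis using gens[OF hh] m[of zs] False xs(2) unfolding h by (auto intro: I_left)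
    qed
  qed
  have unit: "u * p - p \<in> ?I" "p * u - p \<in> ?I" if p: "p \<in> alg_carrier ?F" for p
  proof -
    let ?m = "\<lambda>w. Poly_Mapping.single w (Poly_Mapping.lookup p w)"
    have mono: "u * ?m w - ?m w \<in> ?I \<and> ?m w * u - ?m w \<in> ?I" if "w \<in> Poly_Mapping.keys p" for w
      using monom[of "letters w"] p that by (simp add: free_algebra_def)
    have "u * p - p = (\<Sum>w\<in>Poly_Mapping.keys p. u * ?m w - ?m w)"
      unfolding sum_subtractf sum_distrib_left[symmetric] ncpoly_sum_monomials[symmetric] ..
    then show "u * p - p \<in> ?I" using mono by (simp add: I_sum)
    have "p * u - p = (\<Sum>w\<in>Poly_Mapping.keys p. ?m w * u - ?m w)"
      unfolding sum_subtractf sum_distrib_right[symmetric] ncpoly_sum_monomials[symmetric] ..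
    then show "p * u - p \<in> ?I" using mono by (simp add: I_sum)
  qed
  let ?U = "alg_coset ?F ?I u"
  have U: "?U \<in> alg_carrier ?L"
    unfolding leavitt_path_algebra_eq F.quotient_carrier[OF lpa_ideal] using u by blast
  have id: "?U \<boxtimes>\<^bsub>?L\<^esub> X = X \<and> X \<boxtimes>\<^bsub>?L\<^esub> ?U = X" if X: "X \<in> alg_carrier ?L" for X
  proof -
    obtain p where p: "p \<in> alg_carrier ?F" "X = alg_coset ?F ?I p"
      using X unfolding leavitt_path_algebra_eq F.quotient_carrier[OF lpa_ideal] by blast
    have "alg_coset ?F ?I (u * p) = alg_coset ?F ?I p" "alg_coset ?F ?I (p * u) = alg_coset ?F ?I p"
      using unit[OF p(1)] p(1) u
      by (simp_all add: F.coset_eq_iff[OF lpa_ideal] free_mult free_scale_minus free_simps)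
    then show ?thesis
      unfolding leavitt_path_algebra_eq p(2)
      by (simp add: F.quotient_mult[OF lpa_ideal u p(1)] F.quotient_mult[OF lpa_ideal p(1) u]
          free_simps)
  qed
  have "alg_one ?L = ?U"
    unfolding alg_one_def
  proof (rule the_equality)
    show "?U \<in> alg_carrier ?L \<and> (\<forall>X\<in>alg_carrier ?L. ?U \<boxtimes>\<^bsub>?L\<^esub> X = X \<and> X \<boxtimes>\<^bsub>?L\<^esub> ?U = X)"
      using U id by blast
  next
    fix V
    assume V: "V \<in> alg_carrier ?L \<and> (\<forall>X\<in>alg_carrier ?L. V \<boxtimes>\<^bsub>?L\<^esub> X = X \<and> X \<boxtimes>\<^bsub>?L\<^esub> V = X)"
    then have "V \<boxtimes>\<^bsub>?L\<^esub> ?U = ?U" using U by blast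
    moreover have "V \<boxtimes>\<^bsub>?L\<^esub> ?U = V" using id V by blast
    ultimately show "V = ?U" by simp
  qed
  then show ?thesis by (simp add: u_def)
qed

end

end

theory Submission
  imports Defs "HOL-Library.Countable_Set"
begin

text \<open>
Let \<open>R\<close> be a simple Leavitt path algebra and \<open>D = [R, R]\<close>. If
\<open>1 \<in> D\<close>, then the line spanned by \<open>1\<close> is a Lie ideal of
\<open>D\<close> on which all brackets vanish, so \<open>D\<close> is not simple. Everything else
rests on one dichotomy: a subgroup \<open>U\<close> of \<open>D\<close> with
\<open>[U, D] \<subseteq> U\<close> is central in \<open>R\<close> or equal to \<open>D\<close>. The
central case forces \<open>U = 0\<close>. If there are infinitely many vertices, a central element
is annihilated by some vertex and therefore vanishes. If there are finitely many, the centre is a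
field over which \<open>D\<close> is a vector space, so a nonzero central element of
\<open>D\<close> would put \<open>1\<close> into \<open>D\<close>.

The dichotomy is proved without any assumption on the characteristic, by decomposing
\<open>R\<close> into blocks \<open>i R j\<close> for a complete set of orthogonal idempotents, all
of which generate \<open>R\<close> as an ideal (\<open>central_or_contains_D\<close>). If the
off-diagonal blocks of every element of \<open>U\<close> vanish, then \<open>U\<close> is central.
Otherwise some \<open>u \<in> U\<close> has \<open>j u i \<noteq> 0\<close>, and a third idempotent
\<open>k\<close> isolates this block: for \<open>x \<in> i R j\<close>,
\<open>y \<in> i R k\<close>, \<open>z \<in> k R j\<close> the triple bracket
\<open>[[x, [y, u]], z]\<close> collapses to the single product \<open>- x u y z\<close>. By
simplicity these products span \<open>i R j\<close>. From there brackets with \<open>D\<close>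
spread to all off-diagonal blocks, and a subgroup with this property contains \<open>D\<close>.

A Leavitt path algebra contains three such idempotents as soon as the graph has three vertices, or
two edges \<open>e \<noteq> f\<close> with the same range: then \<open>e e\<^sup>*\<close> and
\<open>f f\<^sup>*\<close> are orthogonal, and a further vertex or a refinement of
\<open>e e\<^sup>*\<close> supplies the third. What remains are graphs with at most two vertices and
at most one edge into each vertex. There every corner \<open>v R v\<close> is the line through
\<open>v\<close>. With one vertex \<open>R \<cong> K\<close>, which is excluded. With two vertices
\<open>R\<close> is a matrix algebra of size two, where the dichotomy holds because
\<open>1 \<notin> D\<close> excludes characteristic two (\<open>central_or_contains_D_two\<close>).

Two facts about the presented algebra are needed: vertices are nonzero, and the corners above are
lines. Both come from representations on spaces of functions that are built from partial injections
indexed by the edges (\<open>branching_system\<close>). Simplicity makes such a representation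
faithful, so that \<open>R\<close> can be replaced by a set of linear operators inside a type of
class \<^class>\<open>ring_1\<close>.
\<close>

section \<open>Lie ideals of the commutators of a simple ring\<close>

definition add_subgroup :: "'a::ab_group_add set \<Rightarrow> bool" where
  "add_subgroup G \<longleftrightarrow> 0 \<in> G \<and> (\<forall>x\<in>G. \<forall>y\<in>G. x - y \<in> G)"

lemma add_subgroupI:
  "0 \<in> G \<Longrightarrow> (\<And>x y. x \<in> G \<Longrightarrow> y \<in> G \<Longrightarrow> x - y \<in> G) \<Longrightarrow> add_subgroup G"
  by (simp add: add_subgroup_def)

lemma add_subgroup_zero: "add_subgroup G \<Longrightarrow> 0 \<in> G"
  and add_subgroup_diff: "add_subgroup G \<Longrightarrow> x \<in> G \<Longrightarrow> y \<in> G \<Longrightarrow> x - y \<in> G"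
  by (auto simp: add_subgroup_def)

lemma add_subgroup_minus: "add_subgroup G \<Longrightarrow> x \<in> G \<Longrightarrow> - x \<in> G"
  using add_subgroup_diff[of G 0 x] add_subgroup_zero[of G] by simp

lemma add_subgroup_add: "add_subgroup G \<Longrightarrow> x \<in> G \<Longrightarrow> y \<in> G \<Longrightarrow> x + y \<in> G"
  using add_subgroup_diff[of G x "- y"] add_subgroup_minus[of G y] by simp

lemma add_subgroup_sum:
  "add_subgroup G \<Longrightarrow> (\<And>i. i \<in> J \<Longrightarrow> f i \<in> G) \<Longrightarrow> sum f J \<in> G"
  by (induction J rule: infinite_finite_induct) (auto simp: add_subgroup_zero add_subgroup_add)

lemma add_subgroup_hull: "add_subgroup (add_subgroup hull X)"
  unfolding hull_def add_subgroup_def by blast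

definition lie_bracket :: "'a::ring \<Rightarrow> 'a \<Rightarrow> 'a" where
  "lie_bracket x y = x * y - y * x"

text \<open>
Only additive combinations are taken. For an algebra the result is still the linear span of the
commutators, since a scalar can be absorbed into one of the two factors; see \<open>commutator_span_image\<close>.
\<close>

definition commutator_span :: "'a::ring set \<Rightarrow> 'a set" where
  "commutator_span R = add_subgroup hull {lie_bracket x y |x y. x \<in> R \<and> y \<in> R}"

lemma add_subgroup_commutator_span: "add_subgroup (commutator_span R)"
  unfolding commutator_span_def by (rule add_subgroup_hull)

lemma lie_bracket_in_commutator_span:
  "x \<in> R \<Longrightarrow> y \<in> R \<Longrightarrow> lie_bracket x y \<in> commutator_span R"
  unfolding commutator_span_def by (rule hull_inc) blast

lemma commutator_span_minimal:
  assumes "add_subgroup G" "\<And>x y. x \<in> R \<Longrightarrow> y \<in> R \<Longrightarrow> lie_bracket x y \<in> G"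
  shows "commutator_span R \<subseteq> G"
  unfolding commutator_span_def by (rule hull_minimal) (use assms in auto)

text \<open>
\<open>R\<close> is the additive span of \<open>R e R\<close>. The element \<open>e\<close> is allowed to lie outside \<open>R\<close>, and the span
is expressed as an induction principle: a subgroup that contains all \<open>x e y\<close> contains \<open>R\<close>.
\<close>

definition full_in :: "'a::ring set \<Rightarrow> 'a \<Rightarrow> bool" where
  "full_in R e \<longleftrightarrow> (\<forall>G. add_subgroup G \<longrightarrow> (\<forall>x\<in>R. \<forall>y\<in>R. x * e * y \<in> G) \<longrightarrow> R \<subseteq> G)"

lemma full_inD:
  "full_in R e \<Longrightarrow> add_subgroup G \<Longrightarrow> (\<And>x y. x \<in> R \<Longrightarrow> y \<in> R \<Longrightarrow> x * e * y \<in> G) \<Longrightarrow> b \<in> R \<Longrightarrow> b \<in> G"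
  unfolding full_in_def by blast

text \<open>
The ambient ring has a unit, but \<open>R\<close> itself may have none, and a unit of \<open>R\<close> may differ from \<open>1\<close>.
\<close>

locale simple_subring =
  fixes R :: "'a::ring_1 set"
  assumes subgroup: "add_subgroup R"
    and mult: "x \<in> R \<Longrightarrow> y \<in> R \<Longrightarrow> x * y \<in> R"
    and full: "a \<in> R \<Longrightarrow> a \<noteq> 0 \<Longrightarrow> full_in R a"
begin

abbreviation D where "D \<equiv> commutator_span R"

lemma D_subset: "D \<subseteq> R"
  by (rule commutator_span_minimal[OF subgroup])
    (simp add: lie_bracket_def add_subgroup_diff[OF subgroup] mult)

text \<open>
This makes complements such as \<open>1 - p - q\<close> full although they may lie outside \<open>R\<close>.
\<close>

lemma full_right_multiple:
  assumes e: "\<And>x. x \<in> R \<Longrightarrow> e * x \<in> R" and z: "z \<in> R" "e * z \<noteq> 0"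
  shows "full_in R e"
  unfolding full_in_def
proof (intro allI impI subsetI)
  fix G b assume G: "add_subgroup G" "\<forall>x\<in>R. \<forall>y\<in>R. x * e * y \<in> G" and b: "b \<in> R"
  show "b \<in> G"
  proof (rule full_inD[OF full[OF e[OF z(1)] z(2)] G(1) _ b])
    fix x y assume "x \<in> R" "y \<in> R"
    then have "x * e * (z * y) \<in> G" using G(2) mult z by blast
    then show "x * (e * z) * y \<in> G" by (simp add: mult.assoc)
  qed
qed

text \<open>
A nonzero central \<open>z\<close> is invertible because \<open>z R\<close> is an ideal, and its inverse \<open>r\<close> is central again.
Multiplication by \<open>r\<close> maps commutators to commutators, so \<open>z \<in> D\<close> would give \<open>e = z r \<in> D\<close>.
\<close>

lemma central_in_D_zero:
  assumes e: "e \<in> R" "e \<notin> D" "\<And>a. a \<in> R \<Longrightarrow> e * a = a" "\<And>a. a \<in> R \<Longrightarrow> a * e = a"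
    and z: "z \<in> D" "\<And>a. a \<in> R \<Longrightarrow> z * a = a * z"
  shows "z = 0"
proof (rule ccontr)
  assume z0: "z \<noteq> 0"
  have zR: "z \<in> R" using z D_subset by blast
  have "e \<in> {z * r |r. r \<in> R}"
  proof (rule full_inD[OF full[OF zR z0] _ _ e(1)])
    show "add_subgroup {z * r |r. r \<in> R}"
    proof (rule add_subgroupI)
      show "0 \<in> {z * r |r. r \<in> R}" using add_subgroup_zero[OF subgroup] mult_zero_right[of z] by force
      fix x y assume "x \<in> {z * r |r. r \<in> R}" "y \<in> {z * r |r. r \<in> R}"
      then obtain r s where "r \<in> R" "s \<in> R" "x = z * r" "y = z * s" by blast
      then have "x - y = z * (r - s)" "r - s \<in> R"
        using add_subgroup_diff[OF subgroup] by (simp_all add: right_diff_distrib)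
      then show "x - y \<in> {z * r |r. r \<in> R}" by blast
    qed
    fix x y assume xy: "x \<in> R" "y \<in> R"
    have "x * z * y = z * (x * y)" using z(2)[OF xy(1)] by (metis mult.assoc)
    then show "x * z * y \<in> {z * r |r. r \<in> R}" using mult[OF xy] by blast
  qed
  then obtain r where r: "r \<in> R" "e = z * r" by blast
  \<comment> \<open>The inverse of a central element is central.\<close>
  have rc: "r * a = a * r" if a: "a \<in> R" for a
  proof -
    have "r * a = r * a * (z * r)" using e(4)[of "r * a"] r mult a by simp
    also have "\<dots> = r * (a * z) * r" by (simp only: mult.assoc)
    also have "\<dots> = (r * z) * (a * r)" by (simp only: z(2)[OF a, symmetric] mult.assoc)
    also have "\<dots> = z * r * (a * r)" by (simp only: z(2)[OF r(1), symmetric])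
    also have "\<dots> = a * r" using e(3)[of "a * r"] r mult a by simp
    finally show ?thesis .
  qed
  have "D \<subseteq> {d. d * r \<in> D}"
  proof (rule commutator_span_minimal)
    show "add_subgroup {d. d * r \<in> D}"
      using add_subgroup_commutator_span[of R] by (auto simp: add_subgroup_def left_diff_distrib)
    fix x y assume xy: "x \<in> R" "y \<in> R"
    have "lie_bracket x y * r = lie_bracket x (y * r)"
      using rc[OF xy(1)] by (simp add: lie_bracket_def algebra_simps)
    then show "lie_bracket x y \<in> {d. d * r \<in> D}"
      using lie_bracket_in_commutator_span[OF xy(1) mult[OF xy(2) r(1)]] by simp
  qed
  then show False using z(1) r(2) e(2) by blast
qed

text \<open>
The ideal generated by \<open>z\<close> is annihilated by \<open>v\<close>. If \<open>z\<close> were nonzero, this ideal would contain \<open>v\<close>.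
\<close>

lemma central_zero:
  assumes v: "v \<in> R" "v * v = v" "v \<noteq> 0" "z * v = 0"
    and z: "z \<in> R" "\<And>a. a \<in> R \<Longrightarrow> z * a = a * z"
  shows "z = 0"
proof (rule ccontr)
  assume "z \<noteq> 0"
  then have "v \<in> {g. v * g = 0}"
  proof (rule full_inD[OF full[OF z(1)] _ _ v(1)])
    fix x y assume xy: "x \<in> R" "y \<in> R"
    have "v * (x * z * y) = v * z * (x * y)" using z(2)[OF xy(1)] by (metis mult.assoc)
    also have "\<dots> = 0" using z(2)[OF v(1)] v(4) by simp
    finally show "x * z * y \<in> {g. v * g = 0}" by simp
  qed (simp add: add_subgroup_def right_diff_distrib)
  then show False using v by simp
qed

end

section \<open>Peirce decompositions\<close>

text \<open>
The idempotents in \<open>P\<close> only have to multiply \<open>R\<close> into itself. So a pair of orthogonal idempotents of a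
ring without unit can be completed by its formal complement.
\<close>

locale peirce = simple_subring R for R :: "'a::ring_1 set" +
  fixes P :: "'a set"
  assumes fin: "finite P" and sum_one: "\<Sum>P = 1"
    and idem: "i \<in> P \<Longrightarrow> i * i = i"
    and orth: "i \<in> P \<Longrightarrow> j \<in> P \<Longrightarrow> i \<noteq> j \<Longrightarrow> i * j = 0"
    and left: "i \<in> P \<Longrightarrow> x \<in> R \<Longrightarrow> i * x \<in> R"
    and right: "i \<in> P \<Longrightarrow> x \<in> R \<Longrightarrow> x * i \<in> R"
begin

lemma idem': "i \<in> P \<Longrightarrow> i * (i * x) = i * x"
  by (simp add: mult.assoc[symmetric] idem)

lemma orth': "i \<in> P \<Longrightarrow> j \<in> P \<Longrightarrow> i \<noteq> j \<Longrightarrow> i * (j * x) = 0"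
  by (simp add: mult.assoc[symmetric] orth)

lemmas peirce_simps = idem idem' orth orth'

lemma decomposition: "x = (\<Sum>i\<in>P. \<Sum>j\<in>P. i * x * j)"
proof -
  have "x = \<Sum>P * x * \<Sum>P" by (simp add: sum_one)
  also have "\<dots> = (\<Sum>i\<in>P. \<Sum>j\<in>P. i * x * j)"
    by (simp only: sum_distrib_right[of _ P x] sum_product)
  finally show ?thesis .
qed

text \<open>
A block may be factored through any full idempotent \<open>m\<close>: the products \<open>(i x m) (m y j)\<close> span \<open>i R j\<close>.
\<close>

lemma corner_induct:
  assumes "full_in R m" "add_subgroup G" "i \<in> P" "j \<in> P"
    and "\<And>x y. x \<in> R \<Longrightarrow> y \<in> R \<Longrightarrow> i * x * m * y * j \<in> G" and "a \<in> R"
  shows "i * a * j \<in> G"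
proof -
  have "a \<in> {g. i * g * j \<in> G}"
    by (rule full_inD[OF assms(1) _ _ assms(6)])
      (use assms in \<open>auto simp: add_subgroup_def algebra_simps\<close>)
  then show ?thesis by simp
qed

text \<open>
If \<open>i\<close> lies in \<open>R\<close>, then \<open>i a j = [i, i a j]\<close>. Factoring \<open>i a j\<close> through a full idempotent replaces
\<open>i\<close> by elements of \<open>i R i\<close>, which covers complements outside \<open>R\<close> as well.
\<close>

lemma off_diagonal_in_D:
  assumes i: "i \<in> P" and j: "j \<in> P" and ne: "i \<noteq> j" and f: "full_in R i \<or> full_in R j" and a: "a \<in> R"
  shows "i * a * j \<in> D"
  using f
proof
  assume f: "full_in R i"
  show ?thesis
  proof (rule corner_induct[OF f add_subgroup_commutator_span i j _ a])
    fix x y assume "x \<in> R" "y \<in> R"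
    then have "lie_bracket (i * x * i) (i * y * j) \<in> D"
      by (intro lie_bracket_in_commutator_span left right i j)
    then show "i * x * i * y * j \<in> D"
      using i j ne by (simp add: lie_bracket_def mult.assoc peirce_simps)
  qed
next
  assume f: "full_in R j"
  show ?thesis
  proof (rule corner_induct[OF f add_subgroup_commutator_span i j _ a])
    fix x y assume "x \<in> R" "y \<in> R"
    then have "lie_bracket (i * x * j) (j * y * j) \<in> D"
      by (intro lie_bracket_in_commutator_span left right i j)
    then show "i * x * j * y * j \<in> D"
      using i j ne by (simp add: lie_bracket_def mult.assoc peirce_simps)
  qed
qed

lemma D_noncommutative:
  assumes i: "i \<in> P" "i \<in> R" "i \<noteq> 0" and j: "j \<in> P" "full_in R j" and ne: "i \<noteq> j"
  shows "\<exists>x\<in>D. \<exists>y\<in>D. lie_bracket x y \<noteq> 0"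
proof (rule ccontr)
  assume no: "\<not> ?thesis"
  have "i * i * i \<in> {0}"
  proof (rule corner_induct[OF j(2) _ i(1) i(1) _ i(2)])
    fix x y assume xy: "x \<in> R" "y \<in> R"
    have "i * x * j \<in> D" "j * y * i \<in> D" using off_diagonal_in_D i j ne xy by metis+
    then have "lie_bracket (i * x * j) (j * y * i) = 0" using no by blast
    then have "i * lie_bracket (i * x * j) (j * y * i) = 0" by simp
    then show "i * x * j * y * i \<in> {0}"
      using i j ne by (simp add: lie_bracket_def algebra_simps peirce_simps)
  qed (simp add: add_subgroup_def)
  then show False using i by (simp add: idem)
qed

end

section \<open>Lie ideals and Peirce decompositions\<close>

locale peirce_lie_ideal = peirce R P for R :: "'a::ring_1 set" and P +
  fixes U :: "'a set"
  assumes U: "add_subgroup U" and U_R: "U \<subseteq> R"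
    and bracket: "u \<in> U \<Longrightarrow> d \<in> D \<Longrightarrow> lie_bracket u d \<in> U"
begin

lemma bracket': "u \<in> U \<Longrightarrow> d \<in> D \<Longrightarrow> lie_bracket d u \<in> U"
  using add_subgroup_minus[OF U bracket[of u d]] by (simp add: lie_bracket_def)

definition contains_block :: "'a \<Rightarrow> 'a \<Rightarrow> bool" where
  "contains_block i j \<longleftrightarrow> (\<forall>a\<in>R. i * a * j \<in> U)"

text \<open>
The heart of the argument. A third idempotent \<open>k\<close> makes it possible to isolate the component \<open>j u i\<close>
in a triple bracket, so that no division by two is needed.
\<close>

lemma block_if_component:
  assumes ijk: "i \<in> P" "j \<in> P" "k \<in> P" "i \<noteq> j" "i \<noteq> k" "j \<noteq> k"
    and f: "full_in R k" "full_in R i \<or> full_in R j"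
    and u: "u \<in> U" "j * u * i \<noteq> 0"
  shows "contains_block i j"
  unfolding contains_block_def
proof
  note s = peirce_simps ijk ijk(4-6)[symmetric]
  fix a0 assume a0: "a0 \<in> R"
  have uR: "u \<in> R" using u U_R by blast
  \<comment> \<open>All other terms of the triple bracket contain a product of two different idempotents of \<open>P\<close>.\<close>
  have 1: "i * a * j * u * i * b * k * c * j \<in> U" if abc: "a \<in> R" "b \<in> R" "c \<in> R" for a b c
  proof -
    have d: "i * a * j \<in> D" "i * b * k \<in> D" "k * c * j \<in> D"
      using off_diagonal_in_D ijk f abc by metis+
    have "lie_bracket (lie_bracket (i * a * j) (lie_bracket (i * b * k) u)) (k * c * j) \<in> U"
      by (intro bracket bracket' d u)
    moreover have "lie_bracket (lie_bracket (i * a * j) (lie_bracket (i * b * k) u)) (k * c * j)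
        = - (i * a * j * u * i * b * k * c * j)"
      by (simp add: lie_bracket_def algebra_simps s)
    ultimately show ?thesis using add_subgroup_minus[OF U] by fastforce
  qed
  have 2: "i * a * j * u * i * b * j \<in> U" if ab: "a \<in> R" "b \<in> R" for a b
  proof -
    have "b \<in> {g. i * a * j * u * i * g * j \<in> U}"
      by (rule full_inD[OF f(1) _ _ ab(2)])
        (use 1[OF ab(1)] U in \<open>auto simp: add_subgroup_def algebra_simps\<close>)
    then show ?thesis by simp
  qed
  have "j * u * i \<in> R" using uR ijk left right by blast
  show "i * a0 * j \<in> U"
    by (rule corner_induct[OF full[OF \<open>j * u * i \<in> R\<close> u(2)] U ijk(1,2) _ a0])
      (use 2 in \<open>simp add: mult.assoc\<close>)
qed

lemma block_spread_right:
  assumes ijk: "i \<in> P" "j \<in> P" "k \<in> P" "i \<noteq> j" "i \<noteq> k" "j \<noteq> k" and f: "full_in R j" and o: "contains_block i j"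
  shows "contains_block i k"
  unfolding contains_block_def
proof
  note s = peirce_simps ijk ijk(4-6)[symmetric]
  fix a assume a: "a \<in> R"
  show "i * a * k \<in> U"
  proof (rule corner_induct[OF f U ijk(1,3) _ a])
    fix x y assume xy: "x \<in> R" "y \<in> R"
    have "lie_bracket (i * x * j) (j * y * k) \<in> U"
      using o xy off_diagonal_in_D[OF ijk(2,3,6)] f by (intro bracket) (auto simp: contains_block_def)
    then show "i * x * j * y * k \<in> U" by (simp add: lie_bracket_def algebra_simps s)
  qed
qed

lemma block_spread_left:
  assumes ijk: "i \<in> P" "j \<in> P" "k \<in> P" "i \<noteq> j" "i \<noteq> k" "j \<noteq> k" and f: "full_in R i" and o: "contains_block i j"
  shows "contains_block k j"
  unfolding contains_block_def
proof
  note s = peirce_simps ijk ijk(4-6)[symmetric]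
  fix a assume a: "a \<in> R"
  show "k * a * j \<in> U"
  proof (rule corner_induct[OF f U ijk(3,2) _ a])
    fix x y assume xy: "x \<in> R" "y \<in> R"
    have "lie_bracket (k * x * i) (i * y * j) \<in> U"
      using o xy off_diagonal_in_D[OF ijk(3,1) ijk(5)[symmetric]] f
      by (intro bracket') (auto simp: contains_block_def)
    then show "k * x * i * y * j \<in> U" by (simp add: lie_bracket_def algebra_simps s)
  qed
qed

lemma all_blocks:
  assumes f: "\<And>i. i \<in> P \<Longrightarrow> full_in R i" and three: "\<And>i j. \<exists>m\<in>P. m \<noteq> i \<and> m \<noteq> j"
    and ij: "i \<in> P" "j \<in> P" "i \<noteq> j" and o: "contains_block i j" and kl: "k \<in> P" "l \<in> P" "k \<noteq> l"
  shows "contains_block k l"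
proof -
  have r: "contains_block a c" if "contains_block a b" "a \<in> P" "b \<in> P" "c \<in> P" "a \<noteq> b" "a \<noteq> c" for a b c
    using block_spread_right[of a b c] that f by (cases "b = c") auto
  have l: "contains_block c b" if "contains_block a b" "a \<in> P" "b \<in> P" "c \<in> P" "a \<noteq> b" "b \<noteq> c" for a b c
    using block_spread_left[of a b c] that f by (cases "a = c") auto
  obtain m where m: "m \<in> P" "m \<noteq> i" "m \<noteq> j" using three by blast
  consider "k \<noteq> j" | "k = j" "l \<noteq> i" | "k = j" "l = i" by blast
  then show ?thesis
  proof cases
    case 1
    then show ?thesis using r[OF l[OF o ij(1,2) kl(1) ij(3)], of l] ij kl by metis
  next
    case 2
    then show ?thesis using l[OF r[OF o ij(1,2) kl(2) ij(3)], of k] ij kl by metis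
  next
    case 3
    have "contains_block i m" using r[OF o ij(1,2) m(1) ij(3)] m by metis
    then have "contains_block j m" using l[of i m j] ij m by metis
    then show ?thesis using r[of j m i] 3 ij m by metis
  qed
qed

text \<open>
The elements \<open>t\<close> with \<open>[t, R] \<subseteq> U\<close> are closed under products, because
\<open>[s t, b] = [s, t b] + [t, b s]\<close>. They contain the off-diagonal blocks, hence the products of two
opposite blocks, which span the diagonal ones.
\<close>

lemma D_subset_if_all_blocks:
  assumes o: "\<And>i j. i \<in> P \<Longrightarrow> j \<in> P \<Longrightarrow> i \<noteq> j \<Longrightarrow> contains_block i j \<and> (\<forall>a\<in>R. i * a * j \<in> D)"
    and two: "\<And>i. i \<in> P \<Longrightarrow> \<exists>m\<in>P. m \<noteq> i \<and> full_in R m"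
  shows "D \<subseteq> U"
proof -
  define T where "T = {t \<in> R. \<forall>b\<in>R. lie_bracket t b \<in> U}"
  have T: "add_subgroup T"
  proof (rule add_subgroupI)
    show "0 \<in> T"
      using add_subgroup_zero[OF U] add_subgroup_zero[OF subgroup] by (simp add: T_def lie_bracket_def)
    fix x y assume xy: "x \<in> T" "y \<in> T"
    have "lie_bracket (x - y) b = lie_bracket x b - lie_bracket y b" for b
      by (simp add: lie_bracket_def algebra_simps)
    then show "x - y \<in> T"
      using xy add_subgroup_diff[OF U] add_subgroup_diff[OF subgroup] by (simp add: T_def)
  qed
  have T_mult: "s * t \<in> T" if "s \<in> T" "t \<in> T" for s t
  proof -
    have "lie_bracket (s * t) b = lie_bracket s (t * b) + lie_bracket t (b * s)" for b
      by (simp add: lie_bracket_def algebra_simps)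
    then show ?thesis using that add_subgroup_add[OF U] mult by (simp add: T_def)
  qed
  have T_off: "i * a * j \<in> T" if ij: "i \<in> P" "j \<in> P" "i \<noteq> j" and a: "a \<in> R" for i j a
    unfolding T_def
  proof (intro CollectI conjI ballI)
    show "i * a * j \<in> R" using ij a left right by blast
    fix b assume b: "b \<in> R"
    have aU: "i * c * j \<in> U" if "c \<in> R" for c using o[OF ij] that by (simp add: contains_block_def)
    have "lie_bracket (i * a * j) (k * b * l) \<in> U" if kl: "k \<in> P" "l \<in> P" for k l
    proof (cases "k = l")
      case False
      then show ?thesis using aU[OF a] o[OF kl False] b bracket by blast
    next
      case True
      consider "k = i" | "k = j" | "k \<noteq> i" "k \<noteq> j" by blast
      then show ?thesis
      proof cases
        case 1
        have "lie_bracket (i * a * j) (k * b * l) = - (i * (b * i * a) * j)"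
          using ij 1 True kl by (simp add: lie_bracket_def mult.assoc peirce_simps)
        then show ?thesis
          using add_subgroup_minus[OF U aU[of "b * i * a"]] a b ij mult right by simp
      next
        case 2
        have "lie_bracket (i * a * j) (k * b * l) = i * (a * j * b) * j"
          using ij 2 True kl by (simp add: lie_bracket_def mult.assoc peirce_simps)
        then show ?thesis using aU[of "a * j * b"] a b ij mult right by simp
      next
        case 3
        have "lie_bracket (i * a * j) (k * b * l) = 0"
          using ij 3 True kl by (simp add: lie_bracket_def mult.assoc peirce_simps)
        then show ?thesis using add_subgroup_zero[OF U] by simp
      qed
    qed
    then have "(\<Sum>k\<in>P. \<Sum>l\<in>P. lie_bracket (i * a * j) (k * b * l)) \<in> U"
      by (intro add_subgroup_sum U)
    moreover have "lie_bracket (i * a * j) b = (\<Sum>k\<in>P. \<Sum>l\<in>P. lie_bracket (i * a * j) (k * b * l))"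
      by (subst decomposition[of b])
        (simp only: lie_bracket_def sum_distrib_left sum_distrib_right sum_subtractf)
    ultimately show "lie_bracket (i * a * j) b \<in> U" by simp
  qed
  have T_diag: "i * a * i \<in> T" if i: "i \<in> P" and a: "a \<in> R" for i a
  proof -
    obtain m where m: "m \<in> P" "m \<noteq> i" "full_in R m" using two[OF i] by blast
    show ?thesis
    proof (rule corner_induct[OF m(3) T i i _ a])
      fix x y assume "x \<in> R" "y \<in> R"
      then have "(i * x * m) * (m * y * i) \<in> T" using T_mult T_off i m by metis
      then show "i * x * m * y * i \<in> T" using m by (simp add: mult.assoc peirce_simps)
    qed
  qed
  have "a \<in> T" if "a \<in> R" for a
  proof -
    have "(\<Sum>i\<in>P. \<Sum>j\<in>P. i * a * j) \<in> T"
      using T_off T_diag that by (intro add_subgroup_sum T) metis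
    then show ?thesis using decomposition[of a] by simp
  qed
  then show ?thesis using U by (intro commutator_span_minimal) (auto simp: T_def)
qed

text \<open>
Bracketing a diagonal \<open>u\<close> with \<open>i b j\<close> stays in the block \<open>i R j\<close>, and there it has to vanish. So \<open>u\<close>
commutes with the off-diagonal blocks, and these generate \<open>R\<close>.
\<close>

lemma central_if_diagonal:
  assumes z: "\<And>u i j. u \<in> U \<Longrightarrow> i \<in> P \<Longrightarrow> j \<in> P \<Longrightarrow> i \<noteq> j \<Longrightarrow> i * u * j = 0"
    and D: "\<And>i j a. i \<in> P \<Longrightarrow> j \<in> P \<Longrightarrow> i \<noteq> j \<Longrightarrow> a \<in> R \<Longrightarrow> i * a * j \<in> D"
    and two: "\<And>i. i \<in> P \<Longrightarrow> \<exists>m\<in>P. m \<noteq> i \<and> full_in R m"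
    and u: "u \<in> U" and a: "a \<in> R"
  shows "u * a = a * u"
proof -
  have pu: "i * u = i * u * i" if i: "i \<in> P" for i
  proof -
    have "i * u = (\<Sum>j\<in>P. i * u * j)" by (simp add: sum_distrib_left[symmetric] sum_one)
    also have "\<dots> = (\<Sum>j\<in>P. if j = i then i * u * i else 0)"
      by (rule sum.cong) (use z u i in auto)
    finally show ?thesis using fin i by simp
  qed
  have up: "u * i = i * u * i" if i: "i \<in> P" for i
  proof -
    have "u * i = (\<Sum>j\<in>P. j * u * i)" by (simp add: sum_distrib_right[symmetric] sum_one)
    also have "\<dots> = (\<Sum>j\<in>P. if j = i then i * u * i else 0)"
      by (rule sum.cong) (use z u i in auto)
    finally show ?thesis using fin i by simp
  qed
  have comm: "i * u = u * i" if "i \<in> P" for i using pu up that by metis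
  have commutes: "u * (i * b * j) = i * b * j * u" if ij: "i \<in> P" "j \<in> P" "i \<noteq> j" and b: "b \<in> R" for i j b
  proof -
    have "i * lie_bracket u (i * b * j) * j = 0"
      using z[OF bracket[OF u D[OF ij b]] ij] .
    moreover have "i * (u * (i * b * j)) * j = u * (i * b * j)"
    proof -
      have "i * (u * (i * b * j)) * j = (i * u) * i * b * (j * j)" by (simp only: mult.assoc)
      also have "\<dots> = u * (i * b * j)" using ij by (simp add: comm mult.assoc idem idem')
      finally show ?thesis .
    qed
    moreover have "i * (i * b * j * u) * j = i * b * j * u"
    proof -
      have "i * (i * b * j * u) * j = (i * i) * b * j * (u * j)" by (simp only: mult.assoc)
      also have "\<dots> = i * b * j * u"
        using ij by (simp add: comm[symmetric] mult.assoc idem idem')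
      finally show ?thesis .
    qed
    ultimately show ?thesis by (simp add: lie_bracket_def algebra_simps)
  qed
  let ?C = "{b. u * b = b * u}"
  have C: "add_subgroup ?C" by (simp add: add_subgroup_def algebra_simps)
  have diag: "i * b * i \<in> ?C" if i: "i \<in> P" and b: "b \<in> R" for i b
  proof -
    obtain m where m: "m \<in> P" "m \<noteq> i" "full_in R m" using two[OF i] by blast
    show ?thesis
    proof (rule corner_induct[OF m(3) C i i _ b])
      fix x y assume "x \<in> R" "y \<in> R"
      then have "u * (i * x * m) = i * x * m * u" "u * (m * y * i) = m * y * i * u"
        using commutes i m by metis+
      then have "u * ((i * x * m) * (m * y * i)) = (i * x * m) * (m * y * i) * u"
        by (metis mult.assoc)
      then show "i * x * m * y * i \<in> ?C" using m by (simp add: mult.assoc peirce_simps)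
    qed
  qed
  have "i * a * j \<in> ?C" if "i \<in> P" "j \<in> P" for i j
    using commutes[OF that _ a] diag[OF that(1) a] by (cases "i = j") simp_all
  then have "(\<Sum>i\<in>P. \<Sum>j\<in>P. i * a * j) \<in> ?C" by (intro add_subgroup_sum C)
  then show ?thesis using decomposition[of a] by simp
qed

theorem central_or_contains_D:
  assumes f: "\<And>i. i \<in> P \<Longrightarrow> full_in R i" and three: "\<And>i j. \<exists>m\<in>P. m \<noteq> i \<and> m \<noteq> j"
  shows "D \<subseteq> U \<or> (\<forall>u\<in>U. \<forall>a\<in>R. u * a = a * u)"
proof (cases "\<exists>u\<in>U. \<exists>i\<in>P. \<exists>j\<in>P. i \<noteq> j \<and> j * u * i \<noteq> 0")
  case True
  then obtain u i j where u: "u \<in> U" "i \<in> P" "j \<in> P" "i \<noteq> j" "j * u * i \<noteq> 0" by blast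
  obtain m where m: "m \<in> P" "m \<noteq> i" "m \<noteq> j" using three by blast
  have "contains_block i j" using block_if_component[of i j m u] u m f by metis
  then have "contains_block k l" if "k \<in> P" "l \<in> P" "k \<noteq> l" for k l using all_blocks f three u that by metis
  then show ?thesis
    using D_subset_if_all_blocks off_diagonal_in_D f three by metis
next
  case False
  then show ?thesis using central_if_diagonal off_diagonal_in_D f three by metis
qed

text \<open>
Without a third idempotent the double bracket \<open>[x, [b x, u]]\<close> only yields the symmetric expression
\<open>c b + b c\<close> with \<open>c = x u i\<close>. If the corner of \<open>i\<close> is commutative, this is \<open>2 c b\<close>, and the factor two is
harmless: if \<open>2 i = 0\<close>, then \<open>i + j = i - j = [x, y]\<close> would be a commutator.
\<close>

lemma block_if_component_two:
  assumes ij: "i \<in> P" "j \<in> P" "i \<noteq> j" "i \<in> R" "i \<noteq> 0" "j \<in> R" "j \<noteq> 0"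
    and xy: "x \<in> R" "y \<in> R" "x * y = i" "y * x = j" "i * x = x" "x * j = x" "j * y = y" "y * i = y"
    and commutative: "\<And>a b. a \<in> R \<Longrightarrow> b \<in> R \<Longrightarrow> i * a * i * (i * b * i) = i * b * i * (i * a * i)"
    and one: "i + j \<notin> D" and u: "u \<in> U" "j * u * i \<noteq> 0"
  shows "contains_block i j" "contains_block j i"
proof -
  note s = peirce_simps ij(1-3) ij(3)[symmetric]
  have f: "full_in R i" "full_in R j" using full ij by auto
  have uR: "u \<in> R" using u U_R by blast
  have xi: "x * i = 0" "x * (i * b) = 0" for b
    using orth[OF ij(2,1)] ij(3) xy(6) by (metis mult.assoc mult_zero_left mult_zero_right)+
  have xx: "x * x = 0" "x * (x * b) = 0" for b
    using xi(1) xy(5) by (metis mult.assoc mult_zero_left)+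
  have D: "x \<in> D" "y \<in> D"
    using off_diagonal_in_D[OF ij(1-3) _ xy(1)] off_diagonal_in_D[OF ij(2,1) _ _ xy(2)] f ij xy by auto
  \<comment> \<open>The component \<open>j u i\<close>, transported into the corner of \<open>i\<close>; it is recovered as \<open>y c\<close>.\<close>
  define c where "c = x * u * i"
  have cR: "c \<in> R" and ic: "i * c = c" and ci: "c * i = c" and yc: "y * c = j * u * i"
    using uR ij xy mult idem unfolding c_def by (auto simp: mult.assoc[symmetric]) (simp add: mult.assoc idem)
  have c0: "c \<noteq> 0" using yc u by auto
  have ii: "i + i \<noteq> 0"
  proof
    assume ii: "i + i = 0"
    have "j + j = y * (i + i) * x" using xy by (simp add: algebra_simps)
    then have "j + j = 0" using ii by simp
    then have "i + j = i - j" by (simp add: eq_neg_iff_add_eq_0)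
    also have "\<dots> = lie_bracket x y" using xy by (simp add: lie_bracket_def)
    finally show False using one lie_bracket_in_commutator_span[OF xy(1,2)] by simp
  qed
  define d where "d = c + c"
  have dR: "d \<in> R" and id: "i * d = d" "d * i = d"
    using cR ic ci add_subgroup_add[OF subgroup] by (auto simp: d_def algebra_simps)
  have id': "i * (d * z) = d * z" "d * (i * z) = d * z" for z
    by (simp_all add: mult.assoc[symmetric] id)
  \<comment> \<open>If \<open>2 c\<close> vanished, then so would \<open>2 i\<close>, since \<open>c\<close> generates \<open>R\<close> as an ideal.\<close>
  have d0: "d \<noteq> 0"
  proof
    assume d0: "d = 0"
    have "i \<in> {g. (i + i) * g * i = 0}"
    proof (rule full_inD[OF full[OF cR c0] _ _ ij(4)])
      fix g t
      have "(i + i) * (g * c * t) * i = i * g * d * t * i"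
        by (simp add: d_def algebra_simps)
      then show "g * c * t \<in> {g. (i + i) * g * i = 0}" using d0 by simp
    qed (simp add: add_subgroup_def right_diff_distrib left_diff_distrib)
    then show False using ii by (simp add: distrib_right s)
  qed
  have dU: "d * (i * a * i) * x \<in> U" if a: "a \<in> R" for a
  proof -
    define b where "b = i * a * i"
    have bR: "b \<in> R" and ib: "i * b = b" "b * i = b"
      using a ij left right by (auto simp: b_def s mult.assoc)
    have xb: "x * b = 0" "x * (b * z) = 0" for z using xi ib by (metis mult.assoc mult_zero_left)+
    have "b * x \<in> D"
      using off_diagonal_in_D[OF ij(1-3) _ mult[OF bR xy(1)]] f ib xy by (metis mult.assoc)
    then have "lie_bracket x (lie_bracket (b * x) u) \<in> U" by (intro bracket' D u)
    moreover have "lie_bracket x (lie_bracket (b * x) u) = - (x * u * b * x + b * x * u * x)"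
      by (simp add: lie_bracket_def algebra_simps xb xx)
    moreover have "x * u * b * x = c * b * x" using ib by (simp add: c_def mult.assoc)
    moreover have "b * x * u * x = b * c * x" using xy by (simp add: c_def mult.assoc)
    moreover have "b * c = c * b"
      using commutative[OF bR cR] ib ic ci by simp
    ultimately have "- (d * b * x) \<in> U" by (simp add: d_def algebra_simps)
    then show ?thesis using add_subgroup_minus[OF U, of "- (d * b * x)"] by (simp add: b_def)
  qed
  have gU: "i * g * i * x \<in> U" if g: "g \<in> R" for g
  proof -
    have "g \<in> {g. i * g * i * x \<in> U}"
    proof (rule full_inD[OF full[OF dR d0] _ _ g])
      fix s t assume st: "s \<in> R" "t \<in> R"
      have "i * (s * d * t) * i * x = i * s * i * (i * d * i) * (i * t * i) * x"
        by (simp add: mult.assoc id id' s xy)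
      also have "\<dots> = i * d * i * (i * s * i) * (i * t * i) * x"
        by (simp only: commutative[OF st(1) dR])
      also have "\<dots> = d * (i * (s * i * t) * i) * x"
        by (simp add: mult.assoc id id' s)
      finally have "i * (s * d * t) * i * x = d * (i * (s * i * t) * i) * x" .
      then show "s * d * t \<in> {g. i * g * i * x \<in> U}"
        using dU[of "s * i * t"] st ij mult by simp
    qed (use U in \<open>auto simp: add_subgroup_def algebra_simps\<close>)
    then show ?thesis by simp
  qed
  show o: "contains_block i j"
    unfolding contains_block_def
  proof
    fix a assume a: "a \<in> R"
    have "i * a * j = i * (a * y) * i * x" by (simp add: mult.assoc xy)
    then show "i * a * j \<in> U" using gU[of "a * y"] a xy mult by simp
  qed
  have "x = i * x * j" using xy by simp
  then have "x \<in> U" using o xy(1) by (metis contains_block_def)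
  show "contains_block j i"
    unfolding contains_block_def
  proof
    fix a assume a: "a \<in> R"
    have "a \<in> {g. j * g * i \<in> U}"
    proof (rule full_inD[OF full[OF add_subgroup_add[OF subgroup ij(4,4)] ii] _ _ a])
      fix g t assume gt: "g \<in> R" "t \<in> R"
      \<comment> \<open>The element \<open>[x, y] = i - j\<close> of \<open>U\<close> acts on \<open>j R i\<close> as multiplication by \<open>- 2\<close>.\<close>
      define z where "z = j * (g * i * t) * i"
      have z: "j * z = z" "z * i = z" "i * z = 0" "z * j = 0" by (simp_all add: z_def s mult.assoc)
      have "g * i * t \<in> R" using gt ij mult by blast
      then have "z \<in> D" using off_diagonal_in_D[OF ij(2,1) ij(3)[symmetric]] f by (simp add: z_def)
      then have "lie_bracket (lie_bracket x y) z \<in> U" by (intro bracket D \<open>x \<in> U\<close>)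
      moreover have "lie_bracket (lie_bracket x y) z = - (z + z)"
      proof -
        have "lie_bracket x y = i - j" by (simp add: lie_bracket_def xy)
        then show ?thesis by (simp add: lie_bracket_def z left_diff_distrib right_diff_distrib)
      qed
      ultimately have "z + z \<in> U" using add_subgroup_minus[OF U, of "- (z + z)"] by simp
      then show "g * (i + i) * t \<in> {g. j * g * i \<in> U}" by (simp add: z_def algebra_simps)
    qed (use U in \<open>auto simp: add_subgroup_def algebra_simps\<close>)
    then show "j * a * i \<in> U" by simp
  qed
qed

text \<open>
This covers the two by two matrices over a field. In characteristic two the identity matrix is a
commutator there, and the hypothesis \<open>p + q \<notin> D\<close> excludes this case.
\<close>

theorem central_or_contains_D_two:
  assumes pq: "p \<in> P" "q \<in> P" "p \<noteq> q" "p \<in> R" "q \<in> R" "p \<noteq> 0" "q \<noteq> 0"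
    and rest: "\<And>k a. k \<in> P \<Longrightarrow> k \<noteq> p \<Longrightarrow> k \<noteq> q \<Longrightarrow> a \<in> R \<Longrightarrow> k * a = 0 \<and> a * k = 0"
    and xy: "x \<in> R" "y \<in> R" "x * y = p" "y * x = q" "p * x = x" "x * q = x" "q * y = y" "y * p = y"
    and commutative: "\<And>i a b. i \<in> {p, q} \<Longrightarrow> a \<in> R \<Longrightarrow> b \<in> R \<Longrightarrow>
          i * a * i * (i * b * i) = i * b * i * (i * a * i)"
    and one: "p + q \<notin> D"
  shows "D \<subseteq> U \<or> (\<forall>u\<in>U. \<forall>a\<in>R. u * a = a * u)"
proof -
  have f: "full_in R p" "full_in R q" using full pq by auto
  have two: "\<exists>m\<in>P. m \<noteq> i \<and> full_in R m" for i using pq f by metis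
  have iRj: "i * a * j = 0" if "i \<in> P" "j \<in> P" "i \<notin> {p, q} \<or> j \<notin> {p, q}" "a \<in> R" for i j a
  proof -
    have "i * a = 0 \<or> a * j = 0" using rest that by auto
    then show ?thesis by (metis mult.assoc mult_zero_left mult_zero_right)
  qed
  have D: "i * a * j \<in> D" if "i \<in> P" "j \<in> P" "i \<noteq> j" "a \<in> R" for i j a
  proof (cases "i \<in> {p, q} \<and> j \<in> {p, q}")
    case True
    then show ?thesis using off_diagonal_in_D that f by auto
  next
    case False
    then show ?thesis using iRj[of i j a] that add_subgroup_zero[OF add_subgroup_commutator_span] by auto
  qed
  show ?thesis
  proof (cases "\<exists>u\<in>U. p * u * q \<noteq> 0 \<or> q * u * p \<noteq> 0")
    case True
    then obtain u where u: "u \<in> U" "p * u * q \<noteq> 0 \<or> q * u * p \<noteq> 0" by blast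
    have "contains_block p q \<and> contains_block q p"
    proof (cases "q * u * p = 0")
      case False
      show ?thesis
        using block_if_component_two[OF pq(1-4,6,5,7) xy commutative[of p] one u(1) False] by simp
    next
      case True
      then have "p * u * q \<noteq> 0" using u by simp
      then show ?thesis
        using block_if_component_two[OF pq(2,1) pq(3)[symmetric] pq(5,7,4,6) xy(2,1,4,3,7,8,5,6)
            commutative[of q] _ u(1)] one by (simp add: add.commute)
    qed
    moreover have "contains_block i j" if "i \<in> P" "j \<in> P" "i \<notin> {p, q} \<or> j \<notin> {p, q}" for i j
      using iRj[OF that] add_subgroup_zero[OF U] by (simp add: contains_block_def)
    ultimately have "contains_block i j" if "i \<in> P" "j \<in> P" "i \<noteq> j" for i j using that by blast
    then show ?thesis using D_subset_if_all_blocks two D by metis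
  next
    case False
    have "i * u * j = 0" if "u \<in> U" "i \<in> P" "j \<in> P" "i \<noteq> j" for u i j
    proof (cases "i \<in> {p, q} \<and> j \<in> {p, q}")
      case True
      then show ?thesis using False that by auto
    next
      case no: False
      then show ?thesis using iRj[of i j u] that U_R by auto
    qed
    then show ?thesis using central_if_diagonal[OF _ D two] by blast
  qed
qed

end

context simple_subring
begin

text \<open>
The third idempotent is the complement \<open>1 - p - q\<close>, for which \<open>z\<close> witnesses that it does not kill \<open>R\<close>.
\<close>

lemma three_idempotents:
  assumes pq: "p \<in> R" "q \<in> R" "p * p = p" "q * q = q" "p * q = 0" "q * p = 0" "p \<noteq> 0" "q \<noteq> 0"
    and z: "z \<in> R" "(1 - p - q) * z \<noteq> 0"
  shows "\<exists>x\<in>D. \<exists>y\<in>D. lie_bracket x y \<noteq> 0"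
    and "add_subgroup U \<Longrightarrow> U \<subseteq> D \<Longrightarrow> (\<And>u d. u \<in> U \<Longrightarrow> d \<in> D \<Longrightarrow> lie_bracket u d \<in> U) \<Longrightarrow>
      D \<subseteq> U \<or> (\<forall>u\<in>U. \<forall>a\<in>R. u * a = a * u)"
proof -
  define r where "r = 1 - p - q"
  have r: "r * r = r" "p * r = 0" "r * p = 0" "q * r = 0" "r * q = 0"
    using pq by (simp_all add: r_def algebra_simps)
  have r0: "r \<noteq> 0" using z r_def by auto
  have ne: "p \<noteq> q" "p \<noteq> r" "q \<noteq> r" using pq r by auto
  have rR: "r * x \<in> R" "x * r \<in> R" if "x \<in> R" for x
  proof -
    have "r * x = x - p * x - q * x" "x * r = x - x * p - x * q"
      by (simp_all only: r_def left_diff_distrib right_diff_distrib mult_1_left mult_1_right)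
    then show "r * x \<in> R" "x * r \<in> R"
      using that pq(1,2) mult add_subgroup_diff[OF subgroup] by simp_all
  qed
  interpret peirce R "{p, q, r}"
  proof
    show "\<Sum>{p, q, r} = 1" using ne by (simp add: r_def)
  qed (use pq r rR mult in auto)
  have f: "full_in R i" if "i \<in> {p, q, r}" for i
    using that full[OF pq(1,7)] full[OF pq(2,8)] full_right_multiple[of r z] rR(1) z
    by (auto simp: r_def)
  show "\<exists>x\<in>D. \<exists>y\<in>D. lie_bracket x y \<noteq> 0"
    by (rule D_noncommutative[of p q]) (use pq f ne in auto)
  assume U: "add_subgroup U" "U \<subseteq> D" "\<And>u d. u \<in> U \<Longrightarrow> d \<in> D \<Longrightarrow> lie_bracket u d \<in> U"
  interpret peirce_lie_ideal R "{p, q, r}" U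
    by unfold_locales (use U D_subset in auto)
  show "D \<subseteq> U \<or> (\<forall>u\<in>U. \<forall>a\<in>R. u * a = a * u)"
  proof (rule central_or_contains_D)
    show "\<exists>m\<in>{p, q, r}. m \<noteq> i \<and> m \<noteq> j" for i j using ne by auto
  qed (rule f)
qed

lemma two_idempotents:
  assumes pq: "p \<in> R" "q \<in> R" "p * p = p" "q * q = q" "p * q = 0" "q * p = 0" "p \<noteq> 0" "q \<noteq> 0"
    and unit: "\<And>a. a \<in> R \<Longrightarrow> (p + q) * a = a" "\<And>a. a \<in> R \<Longrightarrow> a * (p + q) = a"
    and xy: "x \<in> R" "y \<in> R" "x * y = p" "y * x = q" "p * x = x" "x * q = x" "q * y = y" "y * p = y"
    and commutative: "\<And>i a b. i \<in> {p, q} \<Longrightarrow> a \<in> R \<Longrightarrow> b \<in> R \<Longrightarrow>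
          i * a * i * (i * b * i) = i * b * i * (i * a * i)"
    and one: "p + q \<notin> D"
  shows "\<exists>x\<in>D. \<exists>y\<in>D. lie_bracket x y \<noteq> 0"
    and "add_subgroup U \<Longrightarrow> U \<subseteq> D \<Longrightarrow> (\<And>u d. u \<in> U \<Longrightarrow> d \<in> D \<Longrightarrow> lie_bracket u d \<in> U) \<Longrightarrow>
      D \<subseteq> U \<or> (\<forall>u\<in>U. \<forall>a\<in>R. u * a = a * u)"
proof -
  define r where "r = 1 - (p + q)"
  have r: "r * r = r" "p * r = 0" "r * p = 0" "q * r = 0" "r * q = 0"
    using pq by (simp_all add: r_def algebra_simps)
  have ne: "p \<noteq> q" "p \<noteq> r" "q \<noteq> r" using pq r by auto
  have rR: "r * a = 0" "a * r = 0" if "a \<in> R" for a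
    using unit[OF that] by (simp_all only: r_def left_diff_distrib right_diff_distrib) simp_all
  interpret peirce R "{p, q, r}"
  proof
    show "\<Sum>{p, q, r} = 1" using ne by (simp add: r_def)
  qed (use pq r rR mult add_subgroup_zero[OF subgroup] in auto)
  show "\<exists>x\<in>D. \<exists>y\<in>D. lie_bracket x y \<noteq> 0"
    by (rule D_noncommutative[of p q]) (use pq full ne in auto)
  assume U: "add_subgroup U" "U \<subseteq> D" "\<And>u d. u \<in> U \<Longrightarrow> d \<in> D \<Longrightarrow> lie_bracket u d \<in> U"
  interpret peirce_lie_ideal R "{p, q, r}" U
    by unfold_locales (use U D_subset in auto)
  show "D \<subseteq> U \<or> (\<forall>u\<in>U. \<forall>a\<in>R. u * a = a * u)"
    by (rule central_or_contains_D_two[of p q x y])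
      (use pq xy ne rR one commutative in auto)
qed

end

section \<open>Realizing an algebra inside a ring\<close>

text \<open>
An injective homomorphism into a type of class \<^class>\<open>ring_1\<close> turns calculations with the explicit
operations of an algebra record into calculations with \<open>+\<close> and \<open>*\<close>. Local units ensure that \<open>R a R\<close> is
nonzero for every \<open>a \<noteq> 0\<close>.
\<close>

locale realized_algebra = assoc_algebra A for A :: "('k::field, 'a) k_algebra" (structure) +
  fixes h :: "'a \<Rightarrow> 'b::ring_1" and scale :: "'k \<Rightarrow> 'b \<Rightarrow> 'b"
  assumes inj: "inj_on h (alg_carrier A)"
    and h_add: "x \<in> alg_carrier A \<Longrightarrow> y \<in> alg_carrier A \<Longrightarrow> h (x \<boxplus> y) = h x + h y"
    and h_mult: "x \<in> alg_carrier A \<Longrightarrow> y \<in> alg_carrier A \<Longrightarrow> h (x \<boxtimes> y) = h x * h y"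
    and h_scale: "x \<in> alg_carrier A \<Longrightarrow> h (c \<odot> x) = scale c (h x)"
    and scale_diff: "scale c (r - s) = scale c r - scale c s"
    and scale_left: "scale c (r * s) = scale c r * s"
    and scale_right: "scale c (r * s) = r * scale c s"
    and units: "x \<in> alg_carrier A \<Longrightarrow> \<exists>e\<in>h ` alg_carrier A. e * h x = h x \<and> h x * e = h x"
begin

abbreviation R where "R \<equiv> h ` alg_carrier A"

lemma h_zero: "h \<zero> = 0"
  using h_add[OF zero_closed zero_closed] add_zero[OF zero_closed] by simp

lemma h_minus: "x \<in> alg_carrier A \<Longrightarrow> h ((- 1) \<odot> x) = - h x"
  using h_add[of x "(- 1) \<odot> x"] add_neg[of x] h_zero scale_closed by (simp add: eq_neg_iff_add_eq_0 add.commute)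

lemma h_diff: "x \<in> alg_carrier A \<Longrightarrow> y \<in> alg_carrier A \<Longrightarrow> h (x \<boxplus> (- 1) \<odot> y) = h x - h y"
  by (simp add: h_add h_minus scale_closed)

lemma h_commutator:
  "x \<in> alg_carrier A \<Longrightarrow> y \<in> alg_carrier A \<Longrightarrow> h (commutator A x y) = lie_bracket (h x) (h y)"
  by (simp add: commutator_def lie_bracket_def h_diff h_mult mult_closed)

lemma h_eq_iff: "x \<in> alg_carrier A \<Longrightarrow> y \<in> alg_carrier A \<Longrightarrow> h x = h y \<longleftrightarrow> x = y"
  using inj by (auto dest: inj_onD)

lemma scale_zero: "scale c 0 = 0"
  using scale_diff[of c 0 0] by simp

lemma subgroup_image: "subspace_of A S \<Longrightarrow> add_subgroup (h ` S)"
proof (rule add_subgroupI)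
  assume S: "subspace_of A S"
  then show "0 \<in> h ` S" using h_zero by (force simp: subspace_of_def)
  fix x y assume "x \<in> h ` S" "y \<in> h ` S"
  then obtain a b where ab: "a \<in> S" "b \<in> S" "x = h a" "y = h b" by blast
  then have "a \<in> alg_carrier A" "b \<in> alg_carrier A" "a \<boxplus> (- 1) \<odot> b \<in> S"
    using S by (auto simp: subspace_of_def)
  then have "x - y = h (a \<boxplus> (- 1) \<odot> b)" "a \<boxplus> (- 1) \<odot> b \<in> S"
    using ab by (simp_all add: h_diff)
  then show "x - y \<in> h ` S" by blast
qed

lemma R_mult: "x \<in> R \<Longrightarrow> y \<in> R \<Longrightarrow> x * y \<in> R"
  using h_mult mult_closed by (metis (no_types, lifting) image_iff)

lemma R_scale: "x \<in> R \<Longrightarrow> scale c x \<in> R"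
  using h_scale scale_closed by (metis (no_types, lifting) image_iff)

lemma subspace_preimage:
  assumes "add_subgroup G" "\<And>c x. x \<in> G \<Longrightarrow> scale c x \<in> G"
  shows "subspace_of A {x \<in> alg_carrier A. h x \<in> G}"
  using assms by (auto simp: subspace_of_def zero_closed add_closed scale_closed h_zero h_add h_scale
      add_subgroup_zero add_subgroup_add)

text \<open>
The additive span \<open>M\<close> of \<open>R a R\<close> is closed under scalars, so it corresponds to an ideal of the algebra.
It is not zero because \<open>a = e a e\<close> for a local unit \<open>e\<close>.
\<close>

lemma simple_subring_image:
  assumes simple: "simple_assoc_algebra A"
  shows "simple_subring R"
proof
  show "add_subgroup R" by (rule subgroup_image[OF subspace_carrier])
  show "x \<in> R \<Longrightarrow> y \<in> R \<Longrightarrow> x * y \<in> R" for x y by (rule R_mult)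
  fix a assume a: "a \<in> R" "a \<noteq> 0"
  define M where "M = add_subgroup hull {x * a * y |x y. x \<in> R \<and> y \<in> R}"
  have M: "add_subgroup M" unfolding M_def by (rule add_subgroup_hull)
  have gen: "x * a * y \<in> M" if "x \<in> R" "y \<in> R" for x y
    unfolding M_def by (rule hull_inc) (use that in blast)
  have ind: "M \<subseteq> G" if "add_subgroup G" "\<And>x y. x \<in> R \<Longrightarrow> y \<in> R \<Longrightarrow> x * a * y \<in> G" for G
    unfolding M_def by (rule hull_minimal) (use that in auto)
  have M_scale: "scale c m \<in> M" if "m \<in> M" for c m
  proof -
    have "M \<subseteq> {m. scale c m \<in> M}"
    proof (rule ind)
      show "add_subgroup {m. scale c m \<in> M}"
        using M by (auto simp: add_subgroup_def scale_diff scale_zero)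
      show "x * a * y \<in> {m. scale c m \<in> M}" if "x \<in> R" "y \<in> R" for x y
        using gen[OF that(1) R_scale[OF that(2)], of c] by (simp add: scale_right[symmetric])
    qed
    then show ?thesis using that by blast
  qed
  have M_mult: "r * m \<in> M \<and> m * r \<in> M" if "m \<in> M" "r \<in> R" for m r
  proof -
    have "M \<subseteq> {m. r * m \<in> M \<and> m * r \<in> M}"
    proof (rule ind)
      show "add_subgroup {m. r * m \<in> M \<and> m * r \<in> M}"
        using M by (auto simp: add_subgroup_def left_diff_distrib right_diff_distrib)
      show "x * a * y \<in> {m. r * m \<in> M \<and> m * r \<in> M}" if "x \<in> R" "y \<in> R" for x y
        using gen[OF R_mult[OF \<open>r \<in> R\<close> that(1)] that(2)] gen[OF that(1) R_mult[OF that(2) \<open>r \<in> R\<close>]]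
        by (simp add: mult.assoc)
    qed
    then show ?thesis using that by blast
  qed
  let ?J = "{x \<in> alg_carrier A. h x \<in> M}"
  have "two_sided_ideal A ?J"
    using subspace_preimage[OF M M_scale] M_mult
    by (auto simp: two_sided_ideal_def mult_closed h_mult)
  then have "?J = {\<zero>} \<or> ?J = alg_carrier A"
    by (rule simple_assoc_algebra.trivial_ideals[OF simple])
  moreover have "?J \<noteq> {\<zero>}"
  proof
    assume J: "?J = {\<zero>}"
    obtain e where e: "e \<in> R" "e * a = a" "a * e = a" using units a by blast
    then have "a \<in> M" using gen[of e e] by simp
    obtain x where x: "x \<in> alg_carrier A" "a = h x" using a by blast
    with \<open>a \<in> M\<close> have "x \<in> ?J" by simp
    then have "x = \<zero>" unfolding J by simp
    then show False using x a h_zero by simp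
  qed
  ultimately have J: "?J = alg_carrier A" by blast
  show "full_in R a"
    unfolding full_in_def
  proof (intro allI impI)
    fix G assume "add_subgroup G" "\<forall>x\<in>R. \<forall>y\<in>R. x * a * y \<in> G"
    then have "M \<subseteq> G" by (intro ind) auto
    then show "R \<subseteq> G" using J by blast
  qed
qed

lemma commutator_span_image: "h ` commutator_space A = commutator_span R"
proof
  let ?D = "commutator_span R"
  have D_scale: "scale c d \<in> ?D" if "d \<in> ?D" for c d
  proof -
    have "?D \<subseteq> {d. scale c d \<in> ?D}"
    proof (rule commutator_span_minimal)
      show "add_subgroup {d. scale c d \<in> ?D}"
        using add_subgroup_commutator_span[of R] by (auto simp: add_subgroup_def scale_diff scale_zero)
      fix x y assume xy: "x \<in> R" "y \<in> R"
      have "scale c (lie_bracket x y) = lie_bracket (scale c x) y"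
        by (simp add: lie_bracket_def scale_diff scale_left[of c x] scale_right[of c y])
      then show "lie_bracket x y \<in> {d. scale c d \<in> ?D}"
        using lie_bracket_in_commutator_span[OF R_scale[OF xy(1)] xy(2)] by simp
    qed
    then show ?thesis using that by blast
  qed
  have "commutator_space A \<subseteq> {x \<in> alg_carrier A. h x \<in> ?D}"
    unfolding commutator_space_def span_of_def
  proof (rule hull_minimal)
    show "subspace_of A {x \<in> alg_carrier A. h x \<in> ?D}"
      by (rule subspace_preimage[OF add_subgroup_commutator_span D_scale])
    show "{commutator A x y |x y. x \<in> alg_carrier A \<and> y \<in> alg_carrier A}
        \<subseteq> {x \<in> alg_carrier A. h x \<in> ?D}"
    proof clarify
      fix x y assume xy: "x \<in> alg_carrier A" "y \<in> alg_carrier A"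
      have "commutator A x y \<in> alg_carrier A"
        using commutator_closed[OF xy] commutator_subspace by (auto simp: subspace_of_def)
      then show "commutator A x y \<in> alg_carrier A \<and> h (commutator A x y) \<in> ?D"
        using xy by (simp add: h_commutator lie_bracket_in_commutator_span)
    qed
  qed
  then show "h ` commutator_space A \<subseteq> ?D" by blast
  show "?D \<subseteq> h ` commutator_space A"
  proof (rule commutator_span_minimal)
    show "add_subgroup (h ` commutator_space A)" by (rule subgroup_image[OF commutator_subspace])
    fix x y assume "x \<in> R" "y \<in> R"
    then obtain a b where "a \<in> alg_carrier A" "b \<in> alg_carrier A" "x = h a" "y = h b" by blast
    then show "lie_bracket x y \<in> h ` commutator_space A"
      using h_commutator commutator_closed by (metis image_eqI)
  qed
qed

lemma commutator_lie_algebra_simps: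
  "alg_carrier (commutator_lie_algebra A) = commutator_space A"
  "alg_add (commutator_lie_algebra A) = alg_add A"
  "alg_zero (commutator_lie_algebra A) = \<zero>"
  "alg_mult (commutator_lie_algebra A) = commutator A"
  "alg_scale (commutator_lie_algebra A) = alg_scale A"
  by (simp_all add: commutator_lie_algebra_def)

lemma commutator_space_carrier: "x \<in> commutator_space A \<Longrightarrow> x \<in> alg_carrier A"
  using commutator_subspace by (auto simp: subspace_of_def)

lemma subspace_of_commutator_lie_algebra:
  "subspace_of (commutator_lie_algebra A) S \<longleftrightarrow> S \<subseteq> commutator_space A \<and> subspace_of A S"
  using commutator_space_carrier by (auto simp: subspace_of_def commutator_lie_algebra_simps)

text \<open>
Simplicity is reduced to statements about the ring \<open>R\<close> in which scalars no longer occur.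
\<close>

lemma simple_lie_algebra_if:
  assumes dichotomy: "\<And>U. add_subgroup U \<Longrightarrow> U \<subseteq> commutator_span R \<Longrightarrow>
        (\<And>u d. u \<in> U \<Longrightarrow> d \<in> commutator_span R \<Longrightarrow> lie_bracket u d \<in> U) \<Longrightarrow>
        commutator_span R \<subseteq> U \<or> (\<forall>u\<in>U. \<forall>a\<in>R. u * a = a * u)"
    and noncommutative: "\<exists>x\<in>commutator_span R. \<exists>y\<in>commutator_span R. lie_bracket x y \<noteq> 0"
    and centre: "\<And>z. z \<in> commutator_span R \<Longrightarrow> (\<And>a. a \<in> R \<Longrightarrow> z * a = a * z) \<Longrightarrow> z = 0"
  shows "simple_lie_algebra (commutator_lie_algebra A)"
proof -
  let ?L = "commutator_lie_algebra A"
  interpret L: lie_algebra ?L by (rule lie_algebra_commutator_lie_algebra)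
  show ?thesis
  proof
    obtain x y where xy: "x \<in> commutator_space A" "y \<in> commutator_space A"
        "lie_bracket (h x) (h y) \<noteq> 0"
      using noncommutative unfolding commutator_span_image[symmetric] by blast
    have "commutator A x y \<in> product_space ?L"
      unfolding product_space_def span_of_def commutator_lie_algebra_simps
      by (rule hull_inc) (use xy in blast)
    moreover have "commutator A x y \<noteq> \<zero>"
      using xy h_commutator[of x y] h_zero commutator_space_carrier by auto
    ultimately show "product_space ?L \<noteq> {\<zero>\<^bsub>?L\<^esub>}" by (auto simp: commutator_lie_algebra_simps)
  next
    fix I assume I: "lie_ideal ?L I"
    then have IC: "I \<subseteq> commutator_space A" and sub: "subspace_of A I"
      and br: "\<And>a x. a \<in> commutator_space A \<Longrightarrow> x \<in> I \<Longrightarrow> commutator A a x \<in> I"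
      by (auto simp: lie_ideal_def subspace_of_commutator_lie_algebra commutator_lie_algebra_simps)
    have IA: "I \<subseteq> alg_carrier A" using sub by (simp add: subspace_of_def)
    have "commutator_span R \<subseteq> h ` I \<or> (\<forall>u\<in>h ` I. \<forall>a\<in>R. u * a = a * u)"
    proof (rule dichotomy)
      show G: "add_subgroup (h ` I)" by (rule subgroup_image[OF sub])
      show "h ` I \<subseteq> commutator_span R" using IC commutator_span_image by blast
      fix u d assume "u \<in> h ` I" "d \<in> commutator_span R"
      then obtain x a where xa: "x \<in> I" "a \<in> commutator_space A" "u = h x" "d = h a"
        unfolding commutator_span_image[symmetric] by blast
      then have "lie_bracket d u = h (commutator A a x)"
        using h_commutator commutator_space_carrier IA by (metis subsetD)
      then have "lie_bracket d u \<in> h ` I" using br xa by blast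
      then have "- lie_bracket d u \<in> h ` I" by (rule add_subgroup_minus[OF G])
      then show "lie_bracket u d \<in> h ` I" by (simp add: lie_bracket_def)
    qed
    then show "I = {\<zero>\<^bsub>?L\<^esub>} \<or> I = alg_carrier ?L"
    proof
      assume "commutator_span R \<subseteq> h ` I"
      then have "h ` commutator_space A \<subseteq> h ` I" by (simp add: commutator_span_image)
      have "x \<in> I" if x: "x \<in> commutator_space A" for x
      proof -
        obtain y where "y \<in> I" "h x = h y"
          using \<open>h ` commutator_space A \<subseteq> h ` I\<close> x by blast
        then show ?thesis using h_eq_iff[of x y] x commutator_space_carrier IA by auto
      qed
      then show ?thesis using IC by (auto simp: commutator_lie_algebra_simps)
    next
      assume c: "\<forall>u\<in>h ` I. \<forall>a\<in>R. u * a = a * u"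
      have "x = \<zero>" if "x \<in> I" for x
      proof -
        have "h x \<in> commutator_span R" using that IC commutator_span_image by blast
        then have "h x = 0" using centre c that by blast
        then show ?thesis using h_eq_iff[of x \<zero>] h_zero zero_closed IA that by auto
      qed
      moreover have "\<zero> \<in> I" using sub by (simp add: subspace_of_def)
      ultimately have "I = {\<zero>}" by blast
      then show ?thesis by (simp add: commutator_lie_algebra_simps)
    qed
  qed
qed

text \<open>
The line spanned by the identity is a nonzero Lie ideal with zero brackets. If it were all of the
commutator space, the derived algebra would vanish.
\<close>

lemma not_simple_lie_algebra_if:
  assumes e: "e \<in> commutator_span R" "\<And>a. a \<in> R \<Longrightarrow> e * a = a" "\<And>a. a \<in> R \<Longrightarrow> a * e = a"
    and R: "a \<in> R" "a \<noteq> 0"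
  shows "\<not> simple_lie_algebra (commutator_lie_algebra A)"
proof
  let ?L = "commutator_lie_algebra A"
  assume "simple_lie_algebra ?L"
  then interpret L: simple_lie_algebra ?L .
  obtain u where u: "u \<in> commutator_space A" "h u = e"
    using e(1) unfolding commutator_span_image[symmetric] by blast
  note uA = commutator_space_carrier[OF u(1)]
  have eR: "e \<in> R" using u uA by blast
  let ?I = "{c \<odot> u |c. True}"
  have cl: "c \<odot> u \<in> commutator_space A" for c
    using u commutator_subspace by (simp add: subspace_of_def)
  have central: "commutator A (c \<odot> u) x = \<zero>" "commutator A x (c \<odot> u) = \<zero>" if "x \<in> alg_carrier A" for c x
  proof -
    have "scale c e * h x = h x * scale c e"
      using e(2,3)[of "h x"] that by (simp add: scale_left[symmetric] scale_right[symmetric])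
    then have "h (commutator A (c \<odot> u) x) = h \<zero>" "h (commutator A x (c \<odot> u)) = h \<zero>"
      using that uA u(2) h_commutator h_scale h_zero scale_closed by (auto simp: lie_bracket_def)
    moreover have "commutator A (c \<odot> u) x \<in> alg_carrier A" "commutator A x (c \<odot> u) \<in> alg_carrier A"
      using commutator_closed commutator_space_carrier uA that scale_closed by blast+
    ultimately show "commutator A (c \<odot> u) x = \<zero>" "commutator A x (c \<odot> u) = \<zero>"
      using h_eq_iff zero_closed by blast+
  qed
  have zI: "\<zero> \<in> ?I" using scale_zero_left[OF uA] by (metis (mono_tags, lifting) mem_Collect_eq)
  have "subspace_of A ?I"
    unfolding subspace_of_def using zI uA
    by (auto simp: scale_closed add_scale[symmetric] scale_scale)
  then have "lie_ideal ?L ?I"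
    unfolding lie_ideal_def subspace_of_commutator_lie_algebra commutator_lie_algebra_simps
    using cl central(2) commutator_space_carrier zI by auto
  then have "?I = {\<zero>} \<or> ?I = commutator_space A"
    using L.trivial_lie_ideals by (simp add: commutator_lie_algebra_simps)
  moreover have "?I \<noteq> {\<zero>}"
  proof
    assume "?I = {\<zero>}"
    then have "1 \<odot> u = \<zero>" by blast
    then have "e = 0" using u uA h_zero one_scale by auto
    then show False using e(2)[OF R(1)] R(2) by simp
  qed
  ultimately have IC: "commutator_space A = ?I" by blast
  have "commutator A x y = \<zero>" if "x \<in> commutator_space A" "y \<in> commutator_space A" for x y
    using that central(1) commutator_space_carrier unfolding IC by blast
  moreover have "subspace_of ?L {\<zero>}"
    using zI IC
    by (simp add: subspace_of_def commutator_lie_algebra_simps zero_closed add_zero scale_zero_right)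
  ultimately have "product_space ?L \<subseteq> {\<zero>}"
    unfolding product_space_def span_of_def commutator_lie_algebra_simps
    by (intro hull_minimal) blast+
  moreover have "subspace_of ?L (product_space ?L)"
    unfolding product_space_def by (rule L.subspace_span) (use L.mult_closed in auto)
  then have "\<zero> \<in> product_space ?L" by (simp add: subspace_of_def commutator_lie_algebra_simps)
  ultimately show False using L.derived_nonzero by (auto simp: commutator_lie_algebra_simps)
qed

end

section \<open>Linear operators on a function space\<close>

text \<open>
The operators form a ring with unit for every index type, which provides the ambient ring for the
image of a representation.
\<close>

typedef (overloaded) ('x, 'k::field) linop =
  "{T :: ('x \<Rightarrow> 'k) \<Rightarrow> 'x \<Rightarrow> 'k. (\<forall>f g. T (\<lambda>x. f x + g x) = (\<lambda>x. T f x + T g x)) \<and>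
      (\<forall>c f. T (\<lambda>x. c * f x) = (\<lambda>x. c * T f x))}"
  morphisms apply_linop Abs_linop
  by (rule exI[of _ "\<lambda>f. f"]) simp

setup_lifting type_definition_linop

instantiation linop :: (type, field) ring_1
begin

lift_definition zero_linop :: "('a, 'b) linop" is "\<lambda>f x. 0" by simp
lift_definition one_linop :: "('a, 'b) linop" is "\<lambda>f. f" by simp
lift_definition plus_linop :: "('a, 'b) linop \<Rightarrow> ('a, 'b) linop \<Rightarrow> ('a, 'b) linop"
  is "\<lambda>S T f x. S f x + T f x" by (auto simp: algebra_simps)
lift_definition minus_linop :: "('a, 'b) linop \<Rightarrow> ('a, 'b) linop \<Rightarrow> ('a, 'b) linop"
  is "\<lambda>S T f x. S f x - T f x" by (auto simp: algebra_simps)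
lift_definition uminus_linop :: "('a, 'b) linop \<Rightarrow> ('a, 'b) linop"
  is "\<lambda>S f x. - S f x" by (auto simp: algebra_simps)
lift_definition times_linop :: "('a, 'b) linop \<Rightarrow> ('a, 'b) linop \<Rightarrow> ('a, 'b) linop"
  is "\<lambda>S T f. S (T f)" by simp

instance
proof
  fix a b c :: "('a, 'b) linop"
  show "(0 :: ('a, 'b) linop) \<noteq> 1"
  proof
    assume "(0 :: ('a, 'b) linop) = 1"
    then have "apply_linop (0 :: ('a, 'b) linop) (\<lambda>_. 1) = apply_linop 1 (\<lambda>_. 1)" by simp
    then show False by (simp add: zero_linop.rep_eq one_linop.rep_eq fun_eq_iff)
  qed
qed (transfer; simp add: algebra_simps; fail)+

end

lift_definition scale_linop :: "'k::field \<Rightarrow> ('x, 'k) linop \<Rightarrow> ('x, 'k) linop"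
  is "\<lambda>c T f x. c * T f x" by (auto simp: algebra_simps)

lemma apply_linop_simps [simp]:
  "apply_linop 0 f x = 0" "apply_linop 1 f = f"
  "apply_linop (S + T) f x = apply_linop S f x + apply_linop T f x"
  "apply_linop (S - T) f x = apply_linop S f x - apply_linop T f x"
  "apply_linop (S * T) f = apply_linop S (apply_linop T f)"
  "apply_linop (scale_linop c T) f x = c * apply_linop T f x"
  by (transfer; simp)+

lemma apply_linop_sum: "apply_linop (sum F J) f x = (\<Sum>j\<in>J. apply_linop (F j) f x)"
  by (induction J rule: infinite_finite_induct) simp_all

lemma apply_linop_scale: "apply_linop T (\<lambda>x. c * f x) x = c * apply_linop T f x"
  by transfer simp

lemma linop_eqI: "(\<And>f x. apply_linop S f x = apply_linop T f x) \<Longrightarrow> S = T"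
  by (metis apply_linop_inject ext)

lemma scale_linop_simps:
  "scale_linop c (S + T) = scale_linop c S + scale_linop c T"
  "scale_linop c (S - T) = scale_linop c S - scale_linop c T"
  "scale_linop (c + d) T = scale_linop c T + scale_linop d T"
  "scale_linop c (scale_linop d T) = scale_linop (c * d) T"
  "scale_linop c S * T = scale_linop c (S * T)"
  "S * scale_linop c T = scale_linop c (S * T)"
  "scale_linop 1 T = T" "scale_linop 0 T = 0" "scale_linop c 0 = 0"
  by (transfer; simp add: algebra_simps)+

section \<open>Evaluation of noncommutative polynomials\<close>

definition eval_word :: "('g \<Rightarrow> 'r::monoid_mult) \<Rightarrow> 'g fword \<Rightarrow> 'r" where
  "eval_word \<rho> w = prod_list (map \<rho> (letters w))"

definition eval_ncpoly :: "('g \<Rightarrow> ('x, 'k::field) linop) \<Rightarrow> ('g, 'k) ncpoly \<Rightarrow> ('x, 'k) linop" where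
  "eval_ncpoly \<rho> p = (\<Sum>w\<in>Poly_Mapping.keys p. scale_linop (Poly_Mapping.lookup p w) (eval_word \<rho> w))"

lemma eval_word_zero: "eval_word \<rho> 0 = 1"
  by (simp add: eval_word_def zero_fword_def)

lemma eval_word_plus: "eval_word \<rho> (u + w) = eval_word \<rho> u * eval_word \<rho> w"
  by (simp add: eval_word_def plus_fword_def)

lemma eval_ncpoly_superset:
  assumes "finite S" "Poly_Mapping.keys p \<subseteq> S"
  shows "eval_ncpoly \<rho> p = (\<Sum>w\<in>S. scale_linop (Poly_Mapping.lookup p w) (eval_word \<rho> w))"
  unfolding eval_ncpoly_def
  by (rule sum.mono_neutral_left) (use assms in \<open>auto simp: in_keys_iff scale_linop_simps\<close>)

lemma eval_ncpoly_add: "eval_ncpoly \<rho> (p + q) = eval_ncpoly \<rho> p + eval_ncpoly \<rho> q"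
proof -
  let ?S = "Poly_Mapping.keys p \<union> Poly_Mapping.keys q"
  have "eval_ncpoly \<rho> (p + q)
      = (\<Sum>w\<in>?S. scale_linop (Poly_Mapping.lookup (p + q) w) (eval_word \<rho> w))"
    by (rule eval_ncpoly_superset) (use keys_add[of p q] in auto)
  also have "\<dots> = (\<Sum>w\<in>?S. scale_linop (Poly_Mapping.lookup p w) (eval_word \<rho> w))
      + (\<Sum>w\<in>?S. scale_linop (Poly_Mapping.lookup q w) (eval_word \<rho> w))"
    by (simp add: lookup_add scale_linop_simps sum.distrib)
  also have "\<dots> = eval_ncpoly \<rho> p + eval_ncpoly \<rho> q"
    using eval_ncpoly_superset[of ?S p \<rho>] eval_ncpoly_superset[of ?S q \<rho>] by simp
  finally show ?thesis .
qed

lemma eval_ncpoly_zero: "eval_ncpoly \<rho> 0 = 0"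
  by (simp add: eval_ncpoly_def)

lemma eval_ncpoly_diff: "eval_ncpoly \<rho> (p - q) = eval_ncpoly \<rho> p - eval_ncpoly \<rho> q"
  using eval_ncpoly_add[of \<rho> "p - q" q] by simp

lemma eval_ncpoly_sum: "eval_ncpoly \<rho> (sum f J) = (\<Sum>j\<in>J. eval_ncpoly \<rho> (f j))"
  by (induction J rule: infinite_finite_induct) (simp_all add: eval_ncpoly_add eval_ncpoly_zero)

lemma eval_ncpoly_single:
  "eval_ncpoly \<rho> (Poly_Mapping.single w c) = scale_linop c (eval_word \<rho> w)"
  using eval_ncpoly_superset[of "{w}" "Poly_Mapping.single w c" \<rho>] by simp

lemma eval_ncpoly_mult: "eval_ncpoly \<rho> (p * q) = eval_ncpoly \<rho> p * eval_ncpoly \<rho> q"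
proof -
  have "p * q = (\<Sum>u\<in>Poly_Mapping.keys p. \<Sum>w\<in>Poly_Mapping.keys q.
      Poly_Mapping.single u (Poly_Mapping.lookup p u) * Poly_Mapping.single w (Poly_Mapping.lookup q w))"
    by (subst (1) ncpoly_sum_monomials[of p], subst (1) ncpoly_sum_monomials[of q])
      (simp only: sum_product)
  then show ?thesis
    by (simp add: eval_ncpoly_sum mult_single eval_ncpoly_single eval_word_plus)
      (simp add: eval_ncpoly_def sum_product scale_linop_simps mult.commute)
qed

lemma eval_ncpoly_scale:
  "eval_ncpoly \<rho> (Poly_Mapping.map ((*) c) p) = scale_linop c (eval_ncpoly \<rho> p)"
  by (simp add: mult_map_scale_conv_mult eval_ncpoly_mult eval_ncpoly_single eval_word_zero
      scale_linop_simps)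

lemma eval_ncpoly_generator: "eval_ncpoly \<rho> (generator g) = \<rho> g"
  by (simp add: generator_def eval_ncpoly_single eval_word_def scale_linop_simps)

lemmas eval_ncpoly_simps = eval_ncpoly_add eval_ncpoly_zero eval_ncpoly_diff eval_ncpoly_sum
  eval_ncpoly_mult eval_ncpoly_generator

text \<open>
The subalgebra generated by the image of the generators consists of the values of polynomials without
constant term, which is why no closure under \<open>1\<close> is required.
\<close>

lemma eval_ncpoly_induct:
  assumes p: "p \<in> alg_carrier (free_algebra X)"
    and zero: "Q 0" and add: "\<And>a b. Q a \<Longrightarrow> Q b \<Longrightarrow> Q (a + b)"
    and scale: "\<And>c a. Q a \<Longrightarrow> Q (scale_linop c a)"
    and mult: "\<And>a b. Q a \<Longrightarrow> Q b \<Longrightarrow> Q (a * b)"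
    and gen: "\<And>g. g \<in> X \<Longrightarrow> Q (\<rho> g)"
  shows "Q (eval_ncpoly \<rho> p)"
proof -
  have word: "Q (prod_list (map \<rho> xs))" if "xs \<noteq> []" "set xs \<subseteq> X" for xs
    using that
  proof (induction xs rule: list_nonempty_induct)
    case (single x)
    then show ?case using gen by simp
  next
    case (cons x xs)
    then show ?case using gen mult by simp
  qed
  have sum: "Q (sum F J)" if "\<And>j. j \<in> J \<Longrightarrow> Q (F j)" for F :: "'z \<Rightarrow> _" and J
    using that by (induction J rule: infinite_finite_induct) (auto intro: zero add)
  show ?thesis
    unfolding eval_ncpoly_def eval_word_def
    by (intro sum scale word) (use p in \<open>auto simp: free_algebra_def\<close>)
qed

section \<open>Branching systems\<close>

lift_definition partial_map_op :: "('x \<Rightarrow> 'x option) \<Rightarrow> ('x, 'k::field) linop"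
  is "\<lambda>m f x. case m x of None \<Rightarrow> 0 | Some y \<Rightarrow> f y"
  by (auto simp: fun_eq_iff split: option.split)

lemma apply_partial_map_op:
  "apply_linop (partial_map_op m) f x = (case m x of None \<Rightarrow> 0 | Some y \<Rightarrow> f y)"
  by transfer simp

text \<open>
The combinatorial data of a representation of the Leavitt path algebra: the vertex \<open>v\<close> acts by
restriction to \<open>Dom v\<close>, and each edge \<open>e\<close> embeds \<open>Dom (tail G e)\<close> into \<open>Dom (head G e)\<close>. Disjointness of the
images of different edges gives \<open>e\<^sup>* f = 0\<close>, and the covering condition at regular vertices gives
\<open>v = \<Sum> e e\<^sup>*\<close>.
\<close>

locale branching_system = wf_digraph G for G :: "('a, 'b) pre_digraph" +
  fixes Dom :: "'a \<Rightarrow> 'x set" and \<sigma> :: "'b \<Rightarrow> 'x \<Rightarrow> 'x"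
  assumes Dom_disjoint: "v \<in> verts G \<Longrightarrow> w \<in> verts G \<Longrightarrow> v \<noteq> w \<Longrightarrow> x \<in> Dom v \<Longrightarrow> x \<notin> Dom w"
    and \<sigma>_inj: "e \<in> arcs G \<Longrightarrow> inj_on (\<sigma> e) (Dom (tail G e))"
    and \<sigma>_Dom: "e \<in> arcs G \<Longrightarrow> x \<in> Dom (tail G e) \<Longrightarrow> \<sigma> e x \<in> Dom (head G e)"
    and \<sigma>_disjoint: "e \<in> arcs G \<Longrightarrow> f \<in> arcs G \<Longrightarrow> e \<noteq> f \<Longrightarrow>
          x \<in> Dom (tail G e) \<Longrightarrow> y \<in> Dom (tail G f) \<Longrightarrow> \<sigma> e x \<noteq> \<sigma> f y"
    and \<sigma>_cover: "regular_vertex G v \<Longrightarrow> x \<in> Dom v \<Longrightarrow>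
          \<exists>e\<in>edges_into G v. x \<in> \<sigma> e ` Dom (tail G e)"
begin

fun step :: "('a, 'b) lpa_gen \<Rightarrow> 'x \<Rightarrow> 'x option" where
  "step (Vertex v) x = (if x \<in> Dom v then Some x else None)"
| "step (Edge e) x = (if x \<in> \<sigma> e ` Dom (tail G e)
     then Some (the_inv_into (Dom (tail G e)) (\<sigma> e) x) else None)"
| "step (Ghost e) x = (if x \<in> Dom (tail G e) then Some (\<sigma> e x) else None)"

definition op :: "('a, 'b) lpa_gen \<Rightarrow> ('x, 'k::field) linop" where
  "op g = partial_map_op (step g)"

lemma apply_op:
  "apply_linop (op (Vertex v)) f x = (if x \<in> Dom v then f x else 0)"
  "apply_linop (op (Edge e)) f x = (if x \<in> \<sigma> e ` Dom (tail G e)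
     then f (the_inv_into (Dom (tail G e)) (\<sigma> e) x) else 0)"
  "apply_linop (op (Ghost e)) f x = (if x \<in> Dom (tail G e) then f (\<sigma> e x) else 0)"
  by (simp_all add: op_def apply_partial_map_op)

lemma op_vertex:
  "v \<in> verts G \<Longrightarrow> w \<in> verts G \<Longrightarrow> op (Vertex v) * op (Vertex w) = (if v = w then op (Vertex w) else 0)"
  by (rule linop_eqI) (auto simp: apply_op Dom_disjoint)

lemma op_edge:
  assumes "e \<in> arcs G"
  shows "op (Vertex (head G e)) * op (Edge e) = op (Edge e)"
    and "op (Edge e) * op (Vertex (tail G e)) = op (Edge e)"
    and "op (Vertex (tail G e)) * op (Ghost e) = op (Ghost e)"
    and "op (Ghost e) * op (Vertex (head G e)) = op (Ghost e)"
  by (rule linop_eqI; use assms in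
      \<open>auto simp: apply_op \<sigma>_Dom the_inv_into_f_f[OF \<sigma>_inj[OF assms]]\<close>)+

lemma op_ghost_edge:
  assumes "e \<in> arcs G" "f \<in> arcs G"
  shows "op (Ghost e) * op (Edge f) = (if e = f then op (Vertex (tail G e)) else 0)"
proof (rule linop_eqI)
  fix k :: "'x \<Rightarrow> 'k::field" and x
  have "\<sigma> e x \<notin> \<sigma> f ` Dom (tail G f)" if "e \<noteq> f" "x \<in> Dom (tail G e)"
    using \<sigma>_disjoint[OF assms that] by blast
  then show "apply_linop (op (Ghost e) * op (Edge f)) k x
      = apply_linop (if e = f then op (Vertex (tail G e)) else 0) k x"
    using the_inv_into_f_f[OF \<sigma>_inj[OF assms(1)], of x] by (auto simp: apply_op)
qed

lemma apply_edge_ghost: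
  assumes "e \<in> arcs G"
  shows "apply_linop (op (Edge e) * op (Ghost e)) k x = (if x \<in> \<sigma> e ` Dom (tail G e) then k x else 0)"
  using the_inv_into_f_f[OF \<sigma>_inj[OF assms]] by (auto simp: apply_op)

lemma op_regular:
  assumes v: "regular_vertex G v"
  shows "op (Vertex v) = (\<Sum>e\<in>edges_into G v. op (Edge e) * op (Ghost e))"
proof (rule linop_eqI)
  fix k :: "'x \<Rightarrow> 'k::field" and x
  have arcs: "e \<in> arcs G" "head G e = v" if "e \<in> edges_into G v" for e
    using that by (auto simp: edges_into_def)
  have fin: "finite (edges_into G v)" using v by (simp add: regular_vertex_def)
  have s: "apply_linop (\<Sum>e\<in>edges_into G v. op (Edge e) * op (Ghost e)) k x
      = (\<Sum>e\<in>edges_into G v. if x \<in> \<sigma> e ` Dom (tail G e) then k x else 0)"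
    unfolding apply_linop_sum by (intro sum.cong refl apply_edge_ghost arcs(1))
  show "apply_linop (op (Vertex v)) k x
      = apply_linop (\<Sum>e\<in>edges_into G v. op (Edge e) * op (Ghost e)) k x"
  proof (cases "x \<in> Dom v")
    case True
    then obtain e where e: "e \<in> edges_into G v" "x \<in> \<sigma> e ` Dom (tail G e)"
      using \<sigma>_cover[OF v] by blast
    have "x \<in> \<sigma> f ` Dom (tail G f) \<longleftrightarrow> f = e" if "f \<in> edges_into G v" for f
    proof (cases "f = e")
      case False
      then have "x \<notin> \<sigma> f ` Dom (tail G f)"
        using e(2) \<sigma>_disjoint[OF arcs(1)[OF that] arcs(1)[OF e(1)] False] by (metis imageE)
      then show ?thesis using False by simp
    qed (use e in simp)
    then have "(\<Sum>f\<in>edges_into G v. if x \<in> \<sigma> f ` Dom (tail G f) then k x else 0)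
        = (\<Sum>f\<in>edges_into G v. if f = e then k x else 0)" by (intro sum.cong) auto
    then show ?thesis using True s e fin by (simp add: apply_op)
  next
    case False
    then have "x \<notin> \<sigma> e ` Dom (tail G e)" if "e \<in> edges_into G v" for e
      using \<sigma>_Dom arcs[OF that] by blast
    then show ?thesis using False s by (simp add: apply_op)
  qed
qed

lemma eval_relation: "r \<in> lpa_relations G \<Longrightarrow> eval_ncpoly op r = 0"
  unfolding lpa_relations_def
  by (auto simp: eval_ncpoly_simps op_vertex op_edge op_ghost_edge op_regular[symmetric])

end

section \<open>Faithful representations\<close>

context branching_system
begin

lemma evaluation_kernel:
  fixes p :: "(('a, 'b) lpa_gen, 'k::field) ncpoly"
  shows "p \<in> lpa_ideal \<Longrightarrow> eval_ncpoly op p = (0 :: ('x, 'k) linop)"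
proof -
  interpret F: assoc_algebra "lpa_free :: ('k, (('a, 'b) lpa_gen, 'k) ncpoly) k_algebra"
    by (rule assoc_algebra_free)
  let ?N = "{p \<in> alg_carrier lpa_free. eval_ncpoly op p = (0 :: ('x, 'k) linop)}"
  have sc: "c \<odot>\<^bsub>lpa_free\<^esub> p = Poly_Mapping.map ((*) c) p"
    for c and p :: "(('a, 'b) lpa_gen, 'k) ncpoly" by (simp add: free_algebra_def)
  have "lpa_ideal \<subseteq> ?N"
  proof (rule hull_minimal)
    show "lpa_relations G \<subseteq> ?N" using lpa_relations_carrier eval_relation by auto
    have "c \<odot>\<^bsub>lpa_free\<^esub> p \<in> ?N" if "p \<in> ?N" for c p
      using that F.scale_closed[of p c] by (simp add: sc eval_ncpoly_scale scale_linop_simps)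
    then show "two_sided_ideal lpa_free ?N"
      unfolding two_sided_ideal_def subspace_of_def
      by (auto simp: free_simps free_zero free_add free_mult eval_ncpoly_simps)
  qed
  then show "p \<in> lpa_ideal \<Longrightarrow> ?thesis" by blast
qed

text \<open>
The value at a coset is computed from an arbitrary representative; by \<open>evaluation_kernel\<close> the choice
does not matter, see \<open>rep_coset\<close>.
\<close>

definition rep :: "(('a, 'b) lpa_gen, 'k::field) ncpoly set \<Rightarrow> ('x, 'k) linop" where
  "rep X = eval_ncpoly op (SOME p. p \<in> X)"

lemma rep_coset:
  fixes p :: "(('a, 'b) lpa_gen, 'k::field) ncpoly"
  assumes p: "p \<in> alg_carrier lpa_free"
  shows "rep (alg_coset lpa_free lpa_ideal p) = eval_ncpoly op p"
proof -
  interpret F: assoc_algebra "lpa_free :: ('k, (('a, 'b) lpa_gen, 'k) ncpoly) k_algebra"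
    by (rule assoc_algebra_free)
  have "(SOME q. q \<in> alg_coset lpa_free lpa_ideal p) \<in> alg_coset lpa_free lpa_ideal p"
    using F.coset_self[OF lpa_ideal p] by (rule someI)
  then obtain i where "i \<in> lpa_ideal" "(SOME q. q \<in> alg_coset lpa_free lpa_ideal p) = p + i"
    by (auto simp: alg_coset_def free_simps)
  then show ?thesis by (simp add: rep_def eval_ncpoly_add evaluation_kernel)
qed

definition vertex_sum :: "'a set \<Rightarrow> ('x, 'k::field) linop" where
  "vertex_sum W = (\<Sum>v\<in>W. op (Vertex v))"

lemma vertex_sum_op:
  assumes "finite W" "W \<subseteq> verts G" "v \<in> verts G"
  shows "vertex_sum W * op (Vertex v) = (if v \<in> W then op (Vertex v) else 0)"
    and "op (Vertex v) * vertex_sum W = (if v \<in> W then op (Vertex v) else 0)"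
proof -
  have "vertex_sum W * op (Vertex v) = (\<Sum>w\<in>W. if w = v then op (Vertex v) else 0)"
    unfolding vertex_sum_def sum_distrib_right
    by (rule sum.cong) (use assms in \<open>auto simp: op_vertex subset_iff\<close>)
  then show "vertex_sum W * op (Vertex v) = (if v \<in> W then op (Vertex v) else 0)"
    using assms by simp
  have "op (Vertex v) * vertex_sum W = (\<Sum>w\<in>W. if w = v then op (Vertex v) else 0)"
    unfolding vertex_sum_def sum_distrib_left
    by (rule sum.cong) (use assms in \<open>auto simp: op_vertex subset_iff\<close>)
  then show "op (Vertex v) * vertex_sum W = (if v \<in> W then op (Vertex v) else 0)"
    using assms by simp
qed

text \<open>
Every element is supported on finitely many vertices. The statement is made for all larger sets of
vertices at once because two elements need a common unit for their sum and product.
\<close>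

lemma local_units:
  fixes p :: "(('a, 'b) lpa_gen, 'k::field) ncpoly"
  assumes p: "p \<in> alg_carrier lpa_free"
  shows "\<exists>V. finite V \<and> V \<subseteq> verts G \<and> (\<forall>W. finite W \<and> V \<subseteq> W \<and> W \<subseteq> verts G \<longrightarrow>
    vertex_sum W * eval_ncpoly op p = (eval_ncpoly op p :: ('x, 'k) linop) \<and>
    eval_ncpoly op p * vertex_sum W = eval_ncpoly op p)"
proof -
  define unit :: "'a set \<Rightarrow> ('x, 'k) linop \<Rightarrow> bool" where
    "unit V a \<longleftrightarrow> finite V \<and> V \<subseteq> verts G \<and> (\<forall>W. finite W \<and> V \<subseteq> W \<and> W \<subseteq> verts G \<longrightarrow>
      vertex_sum W * a = a \<and> a * vertex_sum W = a)" for V a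
  have "\<exists>V. unit V (eval_ncpoly op p)"
  proof (rule eval_ncpoly_induct[OF p])
    show "\<exists>V. unit V 0" by (rule exI[of _ "{}"]) (simp add: unit_def)
    show "\<exists>V. unit V (a + b)" if ab: "\<exists>V. unit V a" "\<exists>V. unit V b" for a b
    proof -
      obtain V W where "unit V a" "unit W b" using ab by blast
      then have "unit (V \<union> W) (a + b)" by (auto simp: unit_def distrib_left distrib_right)
      then show ?thesis by blast
    qed
    show "\<exists>V. unit V (a * b)" if ab: "\<exists>V. unit V a" "\<exists>V. unit V b" for a b
    proof -
      obtain V W where VW: "unit V a" "unit W b" using ab by blast
      have "vertex_sum X * (a * b) = a * b \<and> a * b * vertex_sum X = a * b"
        if "finite X" "V \<union> W \<subseteq> X" "X \<subseteq> verts G" for X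
      proof -
        have "vertex_sum X * a = a" "b * vertex_sum X = b" using VW that by (auto simp: unit_def)
        then show ?thesis by (metis mult.assoc)
      qed
      then have "unit (V \<union> W) (a * b)" using VW by (simp add: unit_def)
      then show ?thesis by blast
    qed
    show "\<exists>V. unit V (scale_linop c a)" if a: "\<exists>V. unit V a" for c a
    proof -
      obtain V where "unit V a" using a by blast
      then have "unit V (scale_linop c a)" by (simp add: unit_def scale_linop_simps(5,6))
      then show ?thesis by blast
    qed
    fix g assume g: "g \<in> lpa_gens G"
    have unit: "unit {v, w} a"
      if vw: "v \<in> verts G" "w \<in> verts G" "op (Vertex v) * a = a" "a * op (Vertex w) = a" for v w a
    proof -
      have "vertex_sum W * a = a \<and> a * vertex_sum W = a"
        if W: "finite W" "{v, w} \<subseteq> W" "W \<subseteq> verts G" for W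
      proof
        have "vertex_sum W * (op (Vertex v) * a) = op (Vertex v) * a"
          using W by (simp add: mult.assoc[symmetric] vertex_sum_op(1)[OF W(1,3) vw(1)])
        then show "vertex_sum W * a = a" by (simp only: vw(3))
        have "(a * op (Vertex w)) * vertex_sum W = a * op (Vertex w)"
          using W by (simp add: mult.assoc vertex_sum_op(2)[OF W(1,3) vw(2)])
        then show "a * vertex_sum W = a" by (simp only: vw(4))
      qed
      then show ?thesis using vw by (simp add: unit_def)
    qed
    consider v where "g = Vertex v" "v \<in> verts G" | e where "g = Edge e" "e \<in> arcs G"
      | e where "g = Ghost e" "e \<in> arcs G"
      using g by (auto simp: lpa_gens_def)
    then show "\<exists>V. unit V (op g)"
    proof cases
      case 1
      then have "unit {v, v} (op g)" by (intro unit) (simp_all add: op_vertex)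
      then show ?thesis by blast
    next
      case 2
      then have "unit {head G e, tail G e} (op g)" by (intro unit) (simp_all add: op_edge)
      then show ?thesis by blast
    next
      case 3
      then have "unit {tail G e, head G e} (op g)" by (intro unit) (simp_all add: op_edge)
      then show ?thesis by blast
    qed
  qed
  then show ?thesis unfolding unit_def .
qed

end

locale simple_branching_system = branching_system G Dom \<sigma>
  for G :: "('a, 'b) pre_digraph" and Dom :: "'a \<Rightarrow> 'x set" and \<sigma> +
  fixes K :: "'k::field itself"
  assumes simple: "simple_assoc_algebra (leavitt_path_algebra K G)"
    and Dom_nonempty: "v \<in> verts G \<Longrightarrow> Dom v \<noteq> {}"
begin

abbreviation L where "L \<equiv> leavitt_path_algebra K G"

abbreviation F :: "('k, (('a, 'b) lpa_gen, 'k) ncpoly) k_algebra" where "F \<equiv> lpa_free"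

abbreviation \<pi> :: "('a, 'b) lpa_gen \<Rightarrow> ('x, 'k) linop" where "\<pi> \<equiv> op"

abbreviation vertex :: "'a \<Rightarrow> ('x, 'k) linop" where "vertex v \<equiv> op (Vertex v)"
abbreviation edge :: "'b \<Rightarrow> ('x, 'k) linop" where "edge e \<equiv> op (Edge e)"
abbreviation ghost :: "'b \<Rightarrow> ('x, 'k) linop" where "ghost e \<equiv> op (Ghost e)"

lemma L_eq: "L = quotient_algebra F lpa_ideal"
  by (simp add: leavitt_path_algebra_def presented_algebra_def)

lemma free_assoc: "assoc_algebra F"
  by (rule assoc_algebra_free)

lemma L_carrier: "alg_carrier L = alg_coset F lpa_ideal ` alg_carrier F"
  unfolding L_eq by (rule assoc_algebra.quotient_carrier[OF free_assoc lpa_ideal])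

lemma vertex_nonzero: "v \<in> verts G \<Longrightarrow> vertex v \<noteq> 0"
proof
  assume v: "v \<in> verts G" "vertex v = 0"
  obtain x where "x \<in> Dom v" using Dom_nonempty[OF v(1)] by blast
  then have "apply_linop (vertex v) (\<lambda>_. 1) x = 1" by (simp add: apply_op)
  then show False by (simp add: v)
qed

lemma scale_F: "c \<odot>\<^bsub>F\<^esub> p = Poly_Mapping.map ((*) c) p"
  by (simp add: free_algebra_def)

lemma verts_nonempty: "verts G \<noteq> {}"
proof
  assume "verts G = {}"
  then have "lpa_gens G = {}" by (auto simp: lpa_gens_def dest: head_in_verts)
  then have F0: "p = 0" if "p \<in> alg_carrier F" for p
    using that by (auto simp: free_algebra_def simp flip: keys_eq_empty)
  interpret A: assoc_algebra L using simple by (simp add: simple_assoc_algebra_def)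
  have z: "\<zero>\<^bsub>L\<^esub> = alg_coset F lpa_ideal 0"
    unfolding L_eq using assoc_algebra.quotient_zero[OF free_assoc lpa_ideal] by (simp add: free_simps)
  have "x = \<zero>\<^bsub>L\<^esub>" if "x \<in> alg_carrier L" for x
    using that F0 by (auto simp: L_carrier z)
  then have C: "alg_carrier L = {\<zero>\<^bsub>L\<^esub>}" using A.zero_closed by blast
  have "subspace_of L (product_space L)"
    unfolding product_space_def by (rule A.subspace_span) (use A.mult_closed in auto)
  then have "product_space L = {\<zero>\<^bsub>L\<^esub>}" using C by (auto simp: subspace_of_def)
  then show False using simple_assoc_algebra.product_nonzero[OF simple] by blast
qed

text \<open>
The kernel is an ideal of a simple algebra, and it is proper since the vertices act nontrivially.
\<close>

lemma faithful:
  assumes p: "p \<in> alg_carrier F" "eval_ncpoly op p = (0 :: ('x, 'k) linop)"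
  shows "p \<in> lpa_ideal"
proof -
  interpret F: assoc_algebra F by (rule free_assoc)
  let ?c = "alg_coset F lpa_ideal"
  define J where "J = ?c ` {p \<in> alg_carrier F. eval_ncpoly op p = (0 :: ('x, 'k) linop)}"
  note Q = F.quotient_add[OF lpa_ideal] F.quotient_mult[OF lpa_ideal] F.quotient_scale[OF lpa_ideal]
    F.quotient_zero[OF lpa_ideal] F.quotient_carrier[OF lpa_ideal]
  have J_in: "?c p \<in> J" if "p \<in> alg_carrier F" "eval_ncpoly op p = (0 :: ('x, 'k) linop)" for p
    using that unfolding J_def by blast
  have J_elim: "\<exists>x\<in>alg_carrier F. eval_ncpoly op x = (0 :: ('x, 'k) linop) \<and> X = ?c x"
    if "X \<in> J" for X using that unfolding J_def by blast
  have J_scale: "c \<odot>\<^bsub>quotient_algebra F lpa_ideal\<^esub> X \<in> J" if X: "X \<in> J" for c X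
  proof -
    obtain x where x: "x \<in> alg_carrier F" "eval_ncpoly op x = (0 :: ('x, 'k) linop)" "X = ?c x"
      using J_elim[OF X] by blast
    then show ?thesis
      using J_in[OF F.scale_closed[OF x(1), of c]]
      by (simp add: Q scale_F eval_ncpoly_scale scale_linop_simps)
  qed
  have J_add: "X \<boxplus>\<^bsub>quotient_algebra F lpa_ideal\<^esub> Y \<in> J" if X: "X \<in> J" and Y: "Y \<in> J" for X Y
  proof -
    obtain x y where "x \<in> alg_carrier F" "eval_ncpoly op x = (0 :: ('x, 'k) linop)" "X = ?c x"
        "y \<in> alg_carrier F" "eval_ncpoly op y = (0 :: ('x, 'k) linop)" "Y = ?c y"
      using J_elim[OF X] J_elim[OF Y] by blast
    then show ?thesis using J_in[of "x + y"] free_add[of x _ y] by (simp add: Q free_simps eval_ncpoly_simps)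
  qed
  have J_mult: "Y \<boxtimes>\<^bsub>quotient_algebra F lpa_ideal\<^esub> X \<in> J \<and> X \<boxtimes>\<^bsub>quotient_algebra F lpa_ideal\<^esub> Y \<in> J"
    if X: "X \<in> J" and Y: "Y \<in> alg_carrier (quotient_algebra F lpa_ideal)" for X Y
  proof -
    obtain x y where "x \<in> alg_carrier F" "eval_ncpoly op x = (0 :: ('x, 'k) linop)" "X = ?c x"
        "y \<in> alg_carrier F" "Y = ?c y"
      using J_elim[OF X] Y unfolding Q by blast
    then show ?thesis
      using J_in[of "x * y"] J_in[of "y * x"] free_mult[of x _ y] free_mult[of y _ x]
      by (simp add: Q free_simps eval_ncpoly_simps)
  qed
  have J_zero: "\<zero>\<^bsub>quotient_algebra F lpa_ideal\<^esub> \<in> J"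
    using J_in[OF free_zero] by (simp add: Q free_simps eval_ncpoly_simps)
  have J_sub: "J \<subseteq> alg_carrier (quotient_algebra F lpa_ideal)" unfolding J_def Q by blast
  note J_closed = J_zero J_sub J_scale J_add J_mult
  have "two_sided_ideal L J"
    unfolding two_sided_ideal_def subspace_of_def
    by (simp add: J_closed[folded L_eq])
  then have "J = {\<zero>\<^bsub>L\<^esub>} \<or> J = alg_carrier L"
    by (rule simple_assoc_algebra.trivial_ideals[OF simple])
  moreover have "J \<noteq> alg_carrier L"
  proof
    assume JL: "J = alg_carrier L"
    obtain v where v: "v \<in> verts G" using verts_nonempty by blast
    have gv: "gvert v \<in> alg_carrier F" using lpa_generators(1)[OF v] .
    then have "?c (gvert v) \<in> J" unfolding JL L_carrier by blast
    then obtain q where "q \<in> alg_carrier F" "eval_ncpoly op q = (0 :: ('x, 'k) linop)" "?c (gvert v) = ?c q"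
      using J_elim by blast
    then have "eval_ncpoly op (gvert v) = (0 :: ('x, 'k) linop)"
      using rep_coset[OF gv] rep_coset[of q] by simp
    then show False using vertex_nonzero[OF v] by (simp add: eval_ncpoly_generator)
  qed
  ultimately have "?c p = \<zero>\<^bsub>L\<^esub>" using J_in[OF p] by blast
  then have "?c p = ?c 0" unfolding L_eq Q free_simps by simp
  then show ?thesis
    using F.coset_eq_iff[OF lpa_ideal p(1) free_zero]
    by (simp add: free_scale_minus free_simps)
qed

sublocale realized_algebra L rep "scale_linop :: 'k \<Rightarrow> ('x, 'k) linop \<Rightarrow> _"
proof -
  interpret F: assoc_algebra F by (rule free_assoc)
  let ?c = "alg_coset F lpa_ideal"
  note Q = F.quotient_add[OF lpa_ideal] F.quotient_mult[OF lpa_ideal] F.quotient_scale[OF lpa_ideal]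
  interpret A: assoc_algebra L using simple by (simp add: simple_assoc_algebra_def)
  show "realized_algebra L rep (scale_linop :: 'k \<Rightarrow> ('x, 'k) linop \<Rightarrow> _)"
  proof
    show "inj_on rep (alg_carrier L)"
    proof (rule inj_onI)
      fix X Y assume "X \<in> alg_carrier L" "Y \<in> alg_carrier L" and e: "rep X = rep Y"
      then obtain x y where xy: "x \<in> alg_carrier F" "y \<in> alg_carrier F" "X = ?c x" "Y = ?c y"
        unfolding L_carrier by blast
      then have "eval_ncpoly op (x - y) = (0 :: ('x, 'k) linop)"
        using e by (simp add: rep_coset eval_ncpoly_diff)
      then have "x - y \<in> lpa_ideal" using faithful free_diff xy by blast
      then show "X = Y"
        using F.coset_eq_iff[OF lpa_ideal xy(1,2)] xy by (simp add: free_scale_minus free_simps)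
    qed
    fix X Y assume "X \<in> alg_carrier L" "Y \<in> alg_carrier L"
    then obtain x y where xy: "x \<in> alg_carrier F" "y \<in> alg_carrier F" "X = ?c x" "Y = ?c y"
      unfolding L_carrier by blast
    show "rep (X \<boxplus>\<^bsub>L\<^esub> Y) = rep X + rep Y"
      unfolding L_eq xy(3,4) Q(1)[OF xy(1,2)]
      using xy F.add_closed[OF xy(1,2)] by (simp add: rep_coset free_simps eval_ncpoly_simps)
    show "rep (X \<boxtimes>\<^bsub>L\<^esub> Y) = rep X * rep Y"
      unfolding L_eq xy(3,4) Q(2)[OF xy(1,2)]
      using xy F.mult_closed[OF xy(1,2)] by (simp add: rep_coset free_simps eval_ncpoly_simps)
    show "rep (c \<odot>\<^bsub>L\<^esub> X) = scale_linop c (rep X)" for c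
      unfolding L_eq xy(3,4) Q(3)[OF xy(1)]
      using xy F.scale_closed[OF xy(1), of c] by (simp add: rep_coset scale_F eval_ncpoly_scale)
    obtain V where V: "finite V" "V \<subseteq> verts G" "vertex_sum V * eval_ncpoly op x = (eval_ncpoly op x :: ('x, 'k) linop)"
        "(eval_ncpoly op x :: ('x, 'k) linop) * vertex_sum V = eval_ncpoly op x"
      using local_units[OF xy(1)] by blast
    have s: "(\<Sum>v\<in>V. gvert v) \<in> alg_carrier F" using V by (intro free_sum lpa_generators) auto
    then have "rep (?c (\<Sum>v\<in>V. gvert v)) = (vertex_sum V :: ('x, 'k) linop)"
      by (simp add: rep_coset eval_ncpoly_simps vertex_sum_def)
    moreover have "?c (\<Sum>v\<in>V. gvert v) \<in> alg_carrier L" using s unfolding L_carrier by blast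
    ultimately have "vertex_sum V \<in> rep ` alg_carrier L" by (metis imageI)
    then show "\<exists>e\<in>rep ` alg_carrier L. e * rep X = rep X \<and> rep X * e = rep X"
      using V xy by (auto simp: rep_coset)
  qed (simp_all add: scale_linop_simps)
qed

sublocale R: simple_subring R
  by (rule simple_subring_image[OF simple])

lemma op_in_R: "g \<in> lpa_gens G \<Longrightarrow> \<pi> g \<in> R"
proof -
  assume "g \<in> lpa_gens G"
  then have "generator g \<in> alg_carrier F" by (rule free_generator)
  then have "\<pi> g = rep (alg_coset F lpa_ideal (generator g))"
      "alg_coset F lpa_ideal (generator g) \<in> alg_carrier L"
    by (simp_all add: rep_coset eval_ncpoly_generator L_carrier)
  then show "\<pi> g \<in> R" by blast
qed

lemma generators_in_R:
  "v \<in> verts G \<Longrightarrow> vertex v \<in> R" "e \<in> arcs G \<Longrightarrow> edge e \<in> R" "e \<in> arcs G \<Longrightarrow> ghost e \<in> R"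
  by (auto intro!: op_in_R simp: lpa_gens_def)

lemma local_units_R:
  assumes "a \<in> R"
  shows "\<exists>V. finite V \<and> V \<subseteq> verts G \<and> (\<forall>W. finite W \<and> V \<subseteq> W \<and> W \<subseteq> verts G \<longrightarrow>
    vertex_sum W * a = a \<and> a * vertex_sum W = a)"
proof -
  obtain p where "p \<in> alg_carrier F" "a = rep (alg_coset F lpa_ideal p)"
    using assms unfolding L_carrier by blast
  then show ?thesis using local_units[of p] by (simp add: rep_coset)
qed

lemma vertex_sum_verts:
  assumes "finite (verts G)" "a \<in> R"
  shows "vertex_sum (verts G) * a = a" "a * vertex_sum (verts G) = a"
  using local_units_R[OF assms(2)] assms(1) by blast+

text \<open>
Any vertex outside the finite support of \<open>a\<close> will do.
\<close>

lemma annihilating_vertex: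
  assumes "infinite (verts G)" "a \<in> R"
  shows "\<exists>v\<in>verts G. a * vertex v = 0"
proof -
  obtain V where V: "finite V" "V \<subseteq> verts G" "a * vertex_sum V = a"
    using local_units_R[OF assms(2)] by blast
  then have "verts G - V \<noteq> {}" using assms(1) by (metis Diff_eq_empty_iff finite_subset)
  then obtain v where v: "v \<in> verts G" "v \<notin> V" by blast
  have "a * vertex v = a * (vertex_sum V * vertex v)" using V(3) by (simp add: mult.assoc[symmetric])
  also have "\<dots> = 0" using v by (simp add: vertex_sum_op(1)[OF V(1,2) v(1)])
  finally show ?thesis using v by blast
qed

lemma one_carrier_rep:
  assumes fin: "finite (verts G)"
  shows "alg_one L \<in> alg_carrier L" "rep (alg_one L) = vertex_sum (verts G)"
proof -
  have L: "L = leavitt_path_algebra TYPE('k) G" by (simp add: leavitt_path_algebra_def)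
  have s: "(\<Sum>v\<in>verts G. gvert v) \<in> alg_carrier F" by (intro free_sum lpa_generators)
  then show "alg_one L \<in> alg_carrier L"
    unfolding L alg_one_leavitt_path_algebra[OF fin] unfolding L[symmetric] L_carrier by blast
  show "rep (alg_one L) = vertex_sum (verts G)"
    unfolding L alg_one_leavitt_path_algebra[OF fin]
    using s by (simp add: rep_coset eval_ncpoly_simps vertex_sum_def)
qed

lemma one_in_commutators_iff:
  assumes fin: "finite (verts G)"
  shows "alg_one L \<in> commutator_space L \<longleftrightarrow> vertex_sum (verts G) \<in> R.D"
proof
  assume "alg_one L \<in> commutator_space L"
  then show "vertex_sum (verts G) \<in> R.D"
    unfolding one_carrier_rep(2)[OF fin, symmetric] commutator_span_image[symmetric] by blast
next
  assume "vertex_sum (verts G) \<in> R.D"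
  then obtain x where "x \<in> commutator_space L" "rep x = rep (alg_one L)"
    unfolding one_carrier_rep(2)[OF fin, symmetric] commutator_span_image[symmetric] by (metis imageE)
  then show "alg_one L \<in> commutator_space L"
    using h_eq_iff[of x "alg_one L"] commutator_space_carrier one_carrier_rep(1)[OF fin] by simp
qed

section \<open>Lie simplicity for simple Leavitt path algebras\<close>

lemma not_simple_if_one_in_commutators:
  assumes fin: "finite (verts G)" and one: "alg_one L \<in> commutator_space L"
  shows "\<not> simple_lie_algebra (commutator_lie_algebra L)"
proof -
  obtain v where "v \<in> verts G" using verts_nonempty by blast
  then show ?thesis
    using not_simple_lie_algebra_if[of "vertex_sum (verts G)" "vertex v"] one
      one_in_commutators_iff[OF fin] vertex_sum_verts[OF fin] generators_in_R(1) vertex_nonzero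
    by blast
qed

lemma centre_zero:
  assumes unit: "infinite (verts G) \<or> alg_one L \<notin> commutator_space L"
    and z: "z \<in> R.D" "\<And>a. a \<in> R \<Longrightarrow> z * a = a * z"
  shows "z = 0"
proof (cases "finite (verts G)")
  case True
  have "vertex_sum (verts G) \<in> R"
    using one_carrier_rep[OF True] by (metis imageI)
  then show ?thesis
    using R.central_in_D_zero[OF _ _ _ _ z] vertex_sum_verts[OF True] unit True
      one_in_commutators_iff[OF True] by blast
next
  case False
  have zR: "z \<in> R" using z R.D_subset by blast
  obtain v where v: "v \<in> verts G" "z * vertex v = 0" using annihilating_vertex[OF False zR] by blast
  show ?thesis
    by (rule R.central_zero[of "vertex v"])
      (use v zR z vertex_nonzero generators_in_R(1) in \<open>auto simp: op_vertex\<close>)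
qed

lemma simple_if_three_idempotents:
  assumes "infinite (verts G) \<or> alg_one L \<notin> commutator_space L"
    and "p \<in> R" "q \<in> R" "p * p = p" "q * q = q" "p * q = 0" "q * p = 0" "p \<noteq> 0" "q \<noteq> 0"
    and "z \<in> R" "(1 - p - q) * z \<noteq> 0"
  shows "simple_lie_algebra (commutator_lie_algebra L)"
proof (rule simple_lie_algebra_if)
  show "\<exists>x\<in>R.D. \<exists>y\<in>R.D. lie_bracket x y \<noteq> 0"
    by (rule R.three_idempotents(1)[OF assms(2-)])
  show "R.D \<subseteq> U \<or> (\<forall>u\<in>U. \<forall>a\<in>R. u * a = a * u)"
    if "add_subgroup U" "U \<subseteq> R.D" "\<And>u d. u \<in> U \<Longrightarrow> d \<in> R.D \<Longrightarrow> lie_bracket u d \<in> U" for U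
    by (rule R.three_idempotents(2)[OF assms(2-) that])
  show "z = 0" if "z \<in> R.D" "\<And>a. a \<in> R \<Longrightarrow> z * a = a * z" for z
    by (rule centre_zero[OF assms(1) that])
qed

lemma simple_if_three_vertices:
  assumes unit: "infinite (verts G) \<or> alg_one L \<notin> commutator_space L"
    and v: "u \<in> verts G" "v \<in> verts G" "w \<in> verts G" "u \<noteq> v" "u \<noteq> w" "v \<noteq> w"
  shows "simple_lie_algebra (commutator_lie_algebra L)"
proof (rule simple_if_three_idempotents[OF unit, where p = "vertex u" and q = "vertex v" and z = "vertex w"])
  show "(1 - vertex u - vertex v) * vertex w \<noteq> 0"
    using v vertex_nonzero[of w] by (simp add: left_diff_distrib op_vertex)
qed (use v vertex_nonzero generators_in_R in \<open>auto simp: op_vertex\<close>)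

lemma edge_simps:
  assumes "e \<in> arcs G"
  shows "ghost e * edge e = vertex (tail G e)" "ghost e * (edge e * a) = vertex (tail G e) * a"
    "vertex (tail G e) * ghost e = ghost e" "vertex (tail G e) * (ghost e * a) = ghost e * a"
    "edge e * vertex (tail G e) = edge e" "edge e * (vertex (tail G e) * a) = edge e * a"
    "vertex (head G e) * edge e = edge e" "vertex (head G e) * (edge e * a) = edge e * a"
    "ghost e * vertex (head G e) = ghost e" "ghost e * (vertex (head G e) * a) = ghost e * a"
  using assms by (simp_all add: op_ghost_edge op_edge mult.assoc[symmetric])

lemma ghost_edge_zero:
  assumes "e \<in> arcs G" "f \<in> arcs G" "e \<noteq> f"
  shows "ghost e * edge f = 0" "ghost e * (edge f * a) = 0"
  using assms by (simp_all add: op_ghost_edge mult.assoc[symmetric])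

lemma vertex_edge_zero:
  assumes "e \<in> arcs G" "w \<in> verts G" "w \<noteq> head G e"
  shows "vertex w * edge e = 0" "vertex w * (edge e * a) = 0" "ghost e * vertex w = 0"
proof -
  have "vertex w * edge e = vertex w * vertex (head G e) * edge e"
    using assms by (simp add: mult.assoc edge_simps)
  then show "vertex w * edge e = 0" using assms by (simp add: op_vertex)
  then show "vertex w * (edge e * a) = 0" by (simp add: mult.assoc[symmetric])
  have "ghost e * vertex w = ghost e * (vertex (head G e) * vertex w)"
    using assms by (simp add: mult.assoc[symmetric] op_edge)
  then show "ghost e * vertex w = 0" using assms by (simp add: op_vertex)
qed

text \<open>
With a further vertex \<open>w\<close> the idempotents are \<open>w\<close>, \<open>e e\<^sup>*\<close> and a complement that fixes \<open>f\<close>. If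
there is only one vertex, \<open>e\<close> and \<open>f\<close> are loops and the word \<open>e f\<close> exists; the idempotents are then
\<open>f f\<^sup>*\<close>, \<open>e f f\<^sup>* e\<^sup>*\<close> and a complement that fixes \<open>e e\<close>.
\<close>

lemma simple_if_branching:
  assumes unit: "infinite (verts G) \<or> alg_one L \<notin> commutator_space L"
    and ef: "e \<in> arcs G" "f \<in> arcs G" "e \<noteq> f" "head G e = head G f"
  shows "simple_lie_algebra (commutator_lie_algebra L)"
proof (cases "\<exists>w\<in>verts G. w \<noteq> head G e")
  case True
  then obtain w where w: "w \<in> verts G" "w \<noteq> head G e" by blast
  have e0: "edge e * ghost e \<noteq> 0" and f0: "edge f \<noteq> 0"
  proof -
    show "edge f \<noteq> 0" using edge_simps(1)[OF ef(2)] vertex_nonzero ef by auto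
    have "ghost e * (edge e * ghost e) * edge e = vertex (tail G e)"
      using ef by (simp add: mult.assoc edge_simps)
    then show "edge e * ghost e \<noteq> 0" using vertex_nonzero[of "tail G e"] ef by auto
  qed
  show ?thesis
  proof (rule simple_if_three_idempotents[OF unit,
        where p = "vertex w" and q = "edge e * ghost e" and z = "edge f"])
    show "(1 - vertex w - edge e * ghost e) * edge f \<noteq> 0"
      using ef w f0 by (simp add: left_diff_distrib mult.assoc ghost_edge_zero vertex_edge_zero)
    show "edge e * ghost e * vertex w = 0" "vertex w * (edge e * ghost e) = 0"
      using ef w by (simp_all add: mult.assoc vertex_edge_zero)
    show "edge e * ghost e * (edge e * ghost e) = edge e * ghost e"
      using ef by (simp add: mult.assoc edge_simps)
  qed (use ef w e0 vertex_nonzero generators_in_R R.mult in \<open>auto simp: op_vertex\<close>)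
next
  case False
  define v where "v = head G e"
  have v: "v \<in> verts G" "head G e = v" "tail G e = v" "head G f = v" "tail G f = v"
    using False ef head_in_verts tail_in_verts unfolding v_def by metis+
  note s = edge_simps[OF ef(1), unfolded v] edge_simps[OF ef(2), unfolded v]
    ghost_edge_zero[OF ef(1,2,3)] ghost_edge_zero[OF ef(2,1) ef(3)[symmetric]] mult.assoc op_vertex[OF v(1,1)]
  have v0: "vertex v \<noteq> 0" using vertex_nonzero v by blast
  let ?p = "edge f * ghost f" and ?q = "edge e * edge f * ghost f * ghost e"
  have "ghost f * ?p * edge f = vertex v" "ghost f * ghost e * ?q * edge e * edge f = vertex v"
    "ghost e * ghost e * (edge e * edge e) = vertex v"
    by (simp_all add: s)
  then have nz: "?p \<noteq> 0" "?q \<noteq> 0" "edge e * edge e \<noteq> 0"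
    using v0 by auto
  show ?thesis
  proof (rule simple_if_three_idempotents[OF unit _ _ _ _ _ _ nz(1,2), where z = "edge e * edge e"])
    have "(1 - ?p - ?q) * (edge e * edge e) = edge e * edge e"
      by (simp add: left_diff_distrib s)
    then show "(1 - ?p - ?q) * (edge e * edge e) \<noteq> 0" using nz by simp
  qed (use ef generators_in_R R.mult in \<open>simp_all add: s\<close>)
qed

text \<open>
If \<open>Dom v\<close> is a single point, the range of \<open>v\<close> is a line, so \<open>v T v\<close> is determined by the value of \<open>T\<close>
at the indicator function of that point.
\<close>

lemma corner_scalar:
  assumes "Dom v = {x}"
  shows "\<exists>c. vertex v * T * vertex v = scale_linop c (vertex v)"
proof
  let ?\<delta> = "\<lambda>y. if y = x then 1 else 0"
  show "vertex v * T * vertex v = scale_linop (apply_linop T ?\<delta> x) (vertex v)"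
  proof (rule linop_eqI)
    fix f y
    have "apply_linop (vertex v) f = (\<lambda>y. f x * ?\<delta> y)"
      using assms by (auto simp: apply_op)
    then have "apply_linop T (apply_linop (vertex v) f) x = f x * apply_linop T ?\<delta> x"
      by (simp only: apply_linop_scale)
    then show "apply_linop (vertex v * T * vertex v) f y
        = apply_linop (scale_linop (apply_linop T ?\<delta> x) (vertex v)) f y"
      using assms by (auto simp: apply_op(1)[of v])
  qed
qed

lemma scale_vertex_inj:
  assumes "v \<in> verts G" "scale_linop c (vertex v) = scale_linop d (vertex v)"
  shows "c = d"
proof -
  obtain x where "x \<in> Dom v" using Dom_nonempty[OF assms(1)] by blast
  then have "apply_linop (scale_linop k (vertex v)) (\<lambda>_. 1) x = k" for k by (simp add: apply_op)
  then show ?thesis using assms(2) by metis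
qed

lemma base_field_if_one_vertex:
  assumes v: "verts G = {v}" "Dom v = {x}"
  shows "alg_isomorphic L base_field_algebra"
proof -
  have vv: "v \<in> verts G" using v by simp
  have "vertex_sum (verts G) = vertex v" by (simp add: vertex_sum_def v)
  then have unit: "vertex v * a = a" "a * vertex v = a" if "a \<in> R" for a
    using vertex_sum_verts[of a] that v by simp_all
  define f where "f X = (SOME c. rep X = scale_linop c (vertex v))" for X
  have f: "rep X = scale_linop (f X) (vertex v)" if X: "X \<in> alg_carrier L" for X
  proof -
    have "rep X = vertex v * rep X * vertex v" using unit X by simp
    then have "\<exists>c. rep X = scale_linop c (vertex v)" using corner_scalar[OF v(2), of "rep X"] by metis
    then show ?thesis unfolding f_def by (rule someI_ex)
  qed
  have f_eq: "f X = c" if "X \<in> alg_carrier L" "rep X = scale_linop c (vertex v)" for X c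
    using f[OF that(1)] that(2) scale_vertex_inj[OF vv] by metis
  show ?thesis
    unfolding alg_isomorphic_def
  proof (intro exI[of _ f] conjI ballI allI)
    show "bij_betw f (alg_carrier L) (alg_carrier base_field_algebra)"
      unfolding bij_betw_def
    proof
      show "inj_on f (alg_carrier L)"
        using f h_eq_iff by (metis inj_onI)
      obtain V where V: "V \<in> alg_carrier L" "rep V = vertex v"
        using generators_in_R(1)[OF vv] by (metis imageE)
      have "c \<in> f ` alg_carrier L" for c
        using f_eq[OF scale_closed[OF V(1), of c]] scale_closed[OF V(1), of c] h_scale[OF V(1), of c] V(2)
        by (metis imageI)
      then show "f ` alg_carrier L = alg_carrier base_field_algebra"
        by (auto simp: base_field_algebra_def)
    qed
    fix X Y assume XY: "X \<in> alg_carrier L" "Y \<in> alg_carrier L"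
    show "f (X \<boxplus>\<^bsub>L\<^esub> Y) = f X \<boxplus>\<^bsub>base_field_algebra\<^esub> f Y"
      using f_eq[OF add_closed[OF XY], of "f X + f Y"] h_add[OF XY] f[OF XY(1)] f[OF XY(2)]
      by (simp add: base_field_algebra_def scale_linop_simps)
    show "f (X \<boxtimes>\<^bsub>L\<^esub> Y) = f X \<boxtimes>\<^bsub>base_field_algebra\<^esub> f Y"
      using f_eq[OF mult_closed[OF XY], of "f X * f Y"] h_mult[OF XY] f[OF XY(1)] f[OF XY(2)]
      by (simp add: base_field_algebra_def scale_linop_simps op_vertex[OF vv vv] mult.commute)
  next
    fix c X assume X: "X \<in> alg_carrier L"
    show "f (c \<odot>\<^bsub>L\<^esub> X) = c \<odot>\<^bsub>base_field_algebra\<^esub> f X"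
      using f_eq[OF scale_closed[OF X], of c "c * f X"] h_scale[OF X, of c] f[OF X]
      by (simp add: base_field_algebra_def scale_linop_simps)
  qed
qed

text \<open>
Both corners are lines and the two vertices generate \<open>R\<close> as an ideal, so there are matrix units \<open>x\<close>
and \<open>y\<close> that exchange the vertices.
\<close>

lemma simple_if_two_vertices:
  assumes v: "verts G = {u, v}" "u \<noteq> v" "Dom u = {s}" "Dom v = {t}"
    and one: "alg_one L \<notin> commutator_space L"
  shows "simple_lie_algebra (commutator_lie_algebra L)"
proof -
  let ?p = "vertex u" and ?q = "vertex v"
  have uv: "u \<in> verts G" "v \<in> verts G" and fin: "finite (verts G)" using v by simp_all
  note pq = op_vertex[OF uv] op_vertex[OF uv(1,1)] op_vertex[OF uv(2,2)] op_vertex[OF uv(2,1)]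
  have S: "vertex_sum (verts G) = ?p + ?q" using v by (simp add: vertex_sum_def)
  have pR: "?p \<in> R" "?q \<in> R" and p0: "?p \<noteq> 0" "?q \<noteq> 0"
    using uv generators_in_R vertex_nonzero by auto
  have pp: "?p * ?p = ?p" "?q * ?q = ?q" "?p * ?q = 0" "?q * ?p = 0"
    using pq v(2) by auto
  have scalar: "\<exists>c. i * a * i = scale_linop c i" if "i \<in> {?p, ?q}" for i a
    using that corner_scalar[OF v(3)] corner_scalar[OF v(4)] by auto
  \<comment> \<open>Otherwise \<open>p (R q R) p\<close> would be zero, although \<open>R q R\<close> spans \<open>R\<close>.\<close>
  have "\<exists>a\<in>R. \<exists>b\<in>R. ?p * a * ?q * b * ?p \<noteq> 0"
  proof (rule ccontr)
    assume no: "\<not> ?thesis"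
    have "?p \<in> {g. ?p * g * ?p = 0}"
    proof (rule full_inD[OF R.full[OF pR(2) p0(2)] _ _ pR(1)])
      fix a b assume "a \<in> R" "b \<in> R"
      then have "?p * a * ?q * b * ?p = 0" using no by blast
      then show "a * ?q * b \<in> {g. ?p * g * ?p = 0}" by (simp add: mult.assoc)
    qed (simp add: add_subgroup_def left_diff_distrib right_diff_distrib)
    then show False using p0 pp by simp
  qed
  then obtain a b where ab: "a \<in> R" "b \<in> R" "?p * a * ?q * b * ?p \<noteq> 0" by blast
  obtain c where c: "?p * (a * ?q * b) * ?p = scale_linop c ?p" using scalar by blast
  have c0: "c \<noteq> 0" using ab c by (auto simp: mult.assoc scale_linop_simps)
  \<comment> \<open>Rescaling makes \<open>x y = p\<close>. Then \<open>y x\<close> is a nonzero idempotent on the line through \<open>q\<close>, hence \<open>q\<close>.\<close>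
  define x where "x = scale_linop (1 / c) (?p * a * ?q)"
  define y where "y = ?q * b * ?p"
  have xy: "x \<in> R" "y \<in> R" "?p * x = x" "x * ?q = x" "?q * y = y" "y * ?p = y"
    using ab pR pp R.mult R_scale by (simp_all add: x_def y_def scale_linop_simps mult.assoc)
      (simp_all add: mult.assoc[symmetric] pp)
  have "x * y = scale_linop (1 / c) (?p * (a * ?q * b) * ?p)"
    using pp by (simp add: x_def y_def scale_linop_simps mult.assoc) (simp add: mult.assoc[symmetric] pp)
  then have xy1: "x * y = ?p" using c0 unfolding c by (simp add: scale_linop_simps)
  have "y * x = ?q * (y * x) * ?q" using xy by (metis mult.assoc)
  then obtain d where d: "y * x = scale_linop d ?q" using scalar[of ?q "y * x"] by auto
  have "scale_linop (d * d) ?q = (y * x) * (y * x)"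
    unfolding d by (simp add: scale_linop_simps pp)
  also have "\<dots> = y * (x * y) * x" by (simp only: mult.assoc)
  also have "\<dots> = scale_linop d ?q" using xy1 xy d by simp
  finally have "d * d = d" using scale_vertex_inj[OF uv(2)] by blast
  moreover have "d \<noteq> 0"
  proof
    assume "d = 0"
    then have "x * (y * x) * y = 0" using d by (simp add: scale_linop_simps)
    moreover have "x * (y * x) * y = (x * y) * (x * y)" by (simp only: mult.assoc)
    ultimately show False using xy1 pp p0 by simp
  qed
  ultimately have xy2: "y * x = ?q" using d by (simp add: scale_linop_simps)
  have commutative: "i * a * i * (i * b * i) = i * b * i * (i * a * i)" if i: "i \<in> {?p, ?q}" for i a b
  proof -
    obtain k l where "i * a * i = scale_linop k i" "i * b * i = scale_linop l i" using scalar[OF i] by metis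
    then show ?thesis by (simp add: scale_linop_simps mult.commute)
  qed
  have unit: "(?p + ?q) * a = a" "a * (?p + ?q) = a" if "a \<in> R" for a
    using vertex_sum_verts[OF fin that] by (simp_all only: S)
  have oneD: "?p + ?q \<notin> R.D" using one one_in_commutators_iff[OF fin] S by simp
  note two = R.two_idempotents[OF pR pp p0 unit xy(1,2) xy1 xy2 xy(3-6) commutative oneD]
  show ?thesis
  proof (rule simple_lie_algebra_if)
    show "\<exists>x\<in>R.D. \<exists>y\<in>R.D. lie_bracket x y \<noteq> 0" by (rule two(1))
    show "R.D \<subseteq> U \<or> (\<forall>u\<in>U. \<forall>a\<in>R. u * a = a * u)"
      if "add_subgroup U" "U \<subseteq> R.D" "\<And>u d. u \<in> U \<Longrightarrow> d \<in> R.D \<Longrightarrow> lie_bracket u d \<in> U" for U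
      by (rule two(2)[OF _ _ _ that])
    show "z = 0" if "z \<in> R.D" "\<And>a. a \<in> R \<Longrightarrow> z * a = a * z" for z
      by (rule centre_zero[OF _ that]) (use one in auto)
  qed
qed

end

section \<open>Two branching systems\<close>

text \<open>
Functions on the vertices carry a representation when no vertex receives two edges: the image of an
edge is then the whole one-point set of its range, and images of different edges are disjoint.
\<close>

lemma (in wf_digraph) branching_system_if_unbranched:
  assumes "\<And>e f. e \<in> arcs G \<Longrightarrow> f \<in> arcs G \<Longrightarrow> head G e = head G f \<Longrightarrow> e = f"
  shows "branching_system G (\<lambda>v. {v}) (\<lambda>e _. head G e)"
  by unfold_locales (use assms in \<open>auto simp: regular_vertex_def edges_into_def\<close>)

text \<open>
Every \<open>Dom v\<close> is a copy of the same infinite set of pairs of a list of edges and a number. The numbers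
absorb finite branching: at a regular vertex with \<open>k\<close> incoming edges, the edge with index \<open>i < k\<close> maps
\<open>n\<close> to \<open>n k + i\<close>, and division with remainder makes the images a partition. The lists absorb infinite
branching: elsewhere an edge puts itself in front of the list, which gives disjoint images.
\<close>

lemma (in wf_digraph) branching_system_exists:
  "\<exists>(Dom :: 'a \<Rightarrow> ('a \<times> 'b list \<times> nat) set) \<sigma>. branching_system G Dom \<sigma> \<and> (\<forall>v. Dom v \<noteq> {})"
proof -
  define k where "k v = card (edges_into G v)" for v
  define index where "index e = to_nat_on (edges_into G (head G e)) e" for e
  define Dom :: "'a \<Rightarrow> ('a \<times> 'b list \<times> nat) set" where "Dom v = {v} \<times> UNIV" for v
  define \<sigma> :: "'b \<Rightarrow> 'a \<times> 'b list \<times> nat \<Rightarrow> 'a \<times> 'b list \<times> nat" where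
    "\<sigma> e = (\<lambda>(_, l, n). if regular_vertex G (head G e)
       then (head G e, l, n * k (head G e) + index e) else (head G e, e # l, n))" for e
  have bij: "bij_betw (to_nat_on (edges_into G v)) (edges_into G v) {..<k v}" if "regular_vertex G v" for v
    using to_nat_on_finite[of "edges_into G v"] that by (simp add: regular_vertex_def k_def)
  have into: "e \<in> edges_into G (head G e)" if "e \<in> arcs G" for e
    using that by (simp add: edges_into_def)
  have index: "index e < k (head G e)" if "e \<in> arcs G" "regular_vertex G (head G e)" for e
    using bij_betwE[OF bij[OF that(2)]] into[OF that(1)] by (simp add: index_def)
  have digits: "n = m \<and> e = f"
    if "e \<in> arcs G" "f \<in> arcs G" "head G e = head G f" "regular_vertex G (head G e)"
      "n * k (head G e) + index e = m * k (head G f) + index f" for e f n m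
  proof -
    have l: "index e < k (head G e)" "index f < k (head G e)" using index that by metis+
    have "(n * k (head G e) + index e) div k (head G e) = n"
        "(n * k (head G e) + index e) mod k (head G e) = index e" using l(1) by simp_all
    moreover have "(m * k (head G e) + index f) div k (head G e) = m"
        "(m * k (head G e) + index f) mod k (head G e) = index f" using l(2) by simp_all
    ultimately have "n = m" "index e = index f" using that(3,5) by metis+
    then show ?thesis
      using bij_betw_imp_inj_on[OF bij[OF that(4)]] into[OF that(1)] into[OF that(2)] that(3)
      by (auto simp: index_def dest: inj_onD)
  qed
  have "branching_system G Dom \<sigma>"
  proof
    show "x \<notin> Dom w" if "v \<noteq> w" "x \<in> Dom v" for v w x using that by (auto simp: Dom_def)
    show "inj_on (\<sigma> e) (Dom (tail G e))" if e: "e \<in> arcs G" for e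
    proof (rule inj_onI)
      fix x y assume xy: "x \<in> Dom (tail G e)" "y \<in> Dom (tail G e)" and eq: "\<sigma> e x = \<sigma> e y"
      obtain l n l' n' where "x = (tail G e, l, n)" "y = (tail G e, l', n')"
        using xy by (auto simp: Dom_def)
      then show "x = y"
        using eq digits[OF e e refl, of n n'] by (cases "regular_vertex G (head G e)") (simp_all add: \<sigma>_def)
    qed
    show "\<sigma> e x \<in> Dom (head G e)" for e x by (cases x) (simp add: \<sigma>_def Dom_def)
    show "\<sigma> e x \<noteq> \<sigma> f y" if ef: "e \<in> arcs G" "f \<in> arcs G" "e \<noteq> f" for e f x y
    proof
      assume eq: "\<sigma> e x = \<sigma> f y"
      have fst: "fst (\<sigma> e x) = head G e" for e x by (cases x) (simp add: \<sigma>_def)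
      have h: "head G e = head G f" using fst eq by metis
      obtain a l n b l' n' where xy: "x = (a, l, n)" "y = (b, l', n')" by (cases x; cases y) blast
      show False
      proof (cases "regular_vertex G (head G e)")
        case True
        then show ?thesis using eq digits[OF ef(1,2) h True, of n n'] ef(3) h by (simp add: \<sigma>_def xy)
      next
        case False
        then show ?thesis using eq ef(3) h by (simp add: \<sigma>_def xy)
      qed
    qed
    show "\<exists>e\<in>edges_into G v. x \<in> \<sigma> e ` Dom (tail G e)" if v: "regular_vertex G v" "x \<in> Dom v" for v x
    proof -
      obtain l n where x: "x = (v, l, n)" using v(2) by (auto simp: Dom_def)
      have "k v > 0" using v(1) by (simp add: regular_vertex_def k_def card_gt_0_iff)
      then have "n mod k v \<in> {..<k v}" by simp
      then obtain e where e: "e \<in> edges_into G v" "to_nat_on (edges_into G v) e = n mod k v"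
        using bij_betw_imp_surj_on[OF bij[OF v(1)]] by (metis imageE)
      then have "head G e = v" by (simp add: edges_into_def)
      then have "\<sigma> e (tail G e, l, n div k v) = x"
        using v e by (simp add: \<sigma>_def index_def x)
      then show ?thesis using e(1) by (force simp: Dom_def)
    qed
  qed
  moreover have "Dom v \<noteq> {}" for v by (simp add: Dom_def)
  ultimately show ?thesis by blast
qed

theorem theorem3p4:
  fixes E :: "('v, 'e) pre_digraph"
  assumes "wf_digraph E"
    and "simple_assoc_algebra (leavitt_path_algebra TYPE('k::field) E)"
  shows "(infinite (verts E) \<longrightarrow>
            simple_lie_algebra (commutator_lie_algebra (leavitt_path_algebra TYPE('k) E))) \<and>
         (finite (verts E) \<and>
          \<not> alg_isomorphic (leavitt_path_algebra TYPE('k) E) base_field_algebra \<longrightarrow>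
            (simple_lie_algebra (commutator_lie_algebra (leavitt_path_algebra TYPE('k) E)) \<longleftrightarrow>
             alg_one (leavitt_path_algebra TYPE('k) E)
               \<notin> commutator_space (leavitt_path_algebra TYPE('k) E)))"
proof -
  interpret wf_digraph E by (rule assms(1))
  let ?L = "leavitt_path_algebra TYPE('k) E"
  obtain Dom :: "'v \<Rightarrow> ('v \<times> 'e list \<times> nat) set" and \<sigma>
    where B: "branching_system E Dom \<sigma>" "\<And>v. Dom v \<noteq> {}"
    using branching_system_exists by blast
  interpret B: branching_system E Dom \<sigma> by (rule B(1))
  interpret S: simple_branching_system E Dom \<sigma> "TYPE('k)"
    by (intro simple_branching_system.intro simple_branching_system_axioms.intro B assms(2))
  have simple: "simple_lie_algebra (commutator_lie_algebra ?L)"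
    if unit: "infinite (verts E) \<or> alg_one ?L \<notin> commutator_space ?L"
      and nontrivial: "infinite (verts E) \<or> \<not> alg_isomorphic ?L base_field_algebra"
  proof (cases "\<exists>u v w. u \<in> verts E \<and> v \<in> verts E \<and> w \<in> verts E \<and> u \<noteq> v \<and> u \<noteq> w \<and> v \<noteq> w")
    case True
    then show ?thesis using S.simple_if_three_vertices[OF unit] by blast
  next
    case few: False
    obtain u where u: "u \<in> verts E" using S.verts_nonempty by blast
    obtain v where v: "verts E = {u, v}"
    proof (cases "verts E = {u}")
      case False
      then obtain v where "v \<in> verts E" "v \<noteq> u" using u by blast
      then have "verts E = {u, v}" using few u by blast
      then show ?thesis by (rule that)
    qed (use that[of u] in simp)
    then have fin: "finite (verts E)" by simp
    show ?thesis
    proof (cases "\<exists>e f. e \<in> arcs E \<and> f \<in> arcs E \<and> e \<noteq> f \<and> head E e = head E f")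
      case True
      then show ?thesis using S.simple_if_branching[OF unit] by blast
    next
      case False
      then have "branching_system E (\<lambda>v. {v}) (\<lambda>e _. head E e)"
        by (intro branching_system_if_unbranched) blast
      then interpret C: branching_system E "\<lambda>v. {v}" "\<lambda>e _. head E e" .
      interpret T: simple_branching_system E "\<lambda>v. {v}" "\<lambda>e _. head E e" "TYPE('k)"
        by (intro simple_branching_system.intro simple_branching_system_axioms.intro
            C.branching_system_axioms assms(2)) simp
      show ?thesis
      proof (cases "u = v")
        case True
        then show ?thesis using T.base_field_if_one_vertex[of u u] v nontrivial fin by simp
      next
        case False
        then show ?thesis using T.simple_if_two_vertices[of u v u v] v unit fin by simp
      qed
    qed
  qed
  show ?thesis using simple S.not_simple_if_one_in_commutators by blast
qed

end
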